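(* Let $p>q$ be odd primes and let $G\leq\operatorname{Sym}(\Omega)$ be a transitive group of degree $|\Omega|=pq$ admitting a unique (non-trivial) block system $\mathcal{B}$, whose blocks are of size $q$. Let $\overline{G}\leq\operatorname{Sym}(\mathcal{B})$ be the group induced by the action of $G$ on $\mathcal{B}$, and suppose that $H=\operatorname{Ker}(G\to\overline{G})$ is non-trivial. Let $N$ be a minimal normal subgroup of $G$ contained in $H$. (i) If $N$ is non-abelian, then $\rho(G)=1$. (ii) If $N$ is abelian and $H$ admits a derangement, then $\rho(G)=1$.
   Context: All groups are finite. A block of a transitive group $G\leq\operatorname{Sym}(\Omega)$ is a subset $S\subseteq\Omega$ such that for every $g\in G$ either $S^g=S$ or $S^g\cap S=\varnothing$. A block system is a $G$-invariant partition $\{S^g : g\in G\}$ of $\Omega$ for a block $S$; it is non-trivial if $1<|S|<|\Omega|$. A derangement is a permutation of $\Omega$ without fixed points. A subset $\mathcal{F}\subseteq G$ is intersecting if for all $g,h\in\mathcal{F}$ there exists $\omega\in\Omega$ with $\omega^g=\omega^h$. The intersection density of $G$ is $\rho(G)=\max\{|\mathcal{F}|/|G_\omega| : \mathcal{F}\subseteq G \text{ intersecting}\}$, where $G_\omega$ is the stabilizer of a point $\omega\in\Omega$. *)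

theory Defs
  imports "HOL-Algebra.Algebra" "HOL-Computational_Algebra.Primes" "HOL-Library.Disjoint_Sets"
begin

text \<open>
  A permutation group $G \leq \mathrm{Sym}(\Omega)$ is a set \<open>G\<close> with \<open>subgroup G (BijGroup \<Omega>)\<close>.
  Permutations act on the left, so a translate $S^g$ is \<open>g ` S\<close>; every notion below is insensitive
  to the choice between left and right actions.
\<close>

abbreviation perm_group :: "'a set \<Rightarrow> ('a \<Rightarrow> 'a) set \<Rightarrow> ('a \<Rightarrow> 'a) monoid"
  where "perm_group \<Omega> G \<equiv> (BijGroup \<Omega>)\<lparr>carrier := G\<rparr>"

definition transitive_perm_group :: "'a set \<Rightarrow> ('a \<Rightarrow> 'a) set \<Rightarrow> bool"
  where "transitive_perm_group \<Omega> G \<longleftrightarrow>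
    subgroup G (BijGroup \<Omega>) \<and> transitive_action (perm_group \<Omega> G) \<Omega> (\<lambda>g. g)"

definition is_block :: "'a set \<Rightarrow> ('a \<Rightarrow> 'a) set \<Rightarrow> 'a set \<Rightarrow> bool"
  where "is_block \<Omega> G S \<longleftrightarrow> S \<subseteq> \<Omega> \<and> (\<forall>g\<in>G. g ` S = S \<or> g ` S \<inter> S = {})"

definition block_system :: "'a set \<Rightarrow> ('a \<Rightarrow> 'a) set \<Rightarrow> 'a set set \<Rightarrow> bool"
  where "block_system \<Omega> G \<B> \<longleftrightarrow>
    partition_on \<Omega> \<B> \<and> (\<exists>S. is_block \<Omega> G S \<and> \<B> = {g ` S | g. g \<in> G})"

definition nontrivial_block_system :: "'a set \<Rightarrow> ('a \<Rightarrow> 'a) set \<Rightarrow> 'a set set \<Rightarrow> bool"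
  where "nontrivial_block_system \<Omega> G \<B> \<longleftrightarrow>
    block_system \<Omega> G \<B> \<and> (\<forall>S\<in>\<B>. 1 < card S \<and> card S < card \<Omega>)"

definition induced_perm :: "'a set set \<Rightarrow> ('a \<Rightarrow> 'a) \<Rightarrow> 'a set \<Rightarrow> 'a set"
  where "induced_perm \<B> g = (\<lambda>S\<in>\<B>. g ` S)"

definition induced_group :: "'a set set \<Rightarrow> ('a \<Rightarrow> 'a) set \<Rightarrow> ('a set \<Rightarrow> 'a set) set"
  where "induced_group \<B> G = induced_perm \<B> ` G"

definition block_kernel :: "'a set \<Rightarrow> 'a set set \<Rightarrow> ('a \<Rightarrow> 'a) set \<Rightarrow> ('a \<Rightarrow> 'a) set"
  where "block_kernel \<Omega> \<B> G =
    kernel (perm_group \<Omega> G) (perm_group \<B> (induced_group \<B> G)) (induced_perm \<B>)"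

definition minimal_normal_subgroup :: "'g set \<Rightarrow> ('g, 'r) monoid_scheme \<Rightarrow> bool"
  where "minimal_normal_subgroup N G \<longleftrightarrow>
    N \<lhd> G \<and> N \<noteq> {\<one>\<^bsub>G\<^esub>} \<and> (\<forall>K. K \<lhd> G \<and> K \<subseteq> N \<longrightarrow> K = {\<one>\<^bsub>G\<^esub>} \<or> K = N)"

definition derangement :: "'a set \<Rightarrow> ('a \<Rightarrow> 'a) \<Rightarrow> bool"
  where "derangement \<Omega> g \<longleftrightarrow> g \<in> carrier (BijGroup \<Omega>) \<and> (\<forall>\<omega>\<in>\<Omega>. g \<omega> \<noteq> \<omega>)"

definition intersecting :: "'a set \<Rightarrow> ('a \<Rightarrow> 'a) set \<Rightarrow> bool"
  where "intersecting \<Omega> \<F> \<longleftrightarrow> (\<forall>g\<in>\<F>. \<forall>h\<in>\<F>. \<exists>\<omega>\<in>\<Omega>. g \<omega> = h \<omega>)"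

text \<open>
  The stabilizer order does not depend on the chosen point, see \<open>intersection_density_eq\<close>.
\<close>

definition intersection_density :: "'a set \<Rightarrow> ('a \<Rightarrow> 'a) set \<Rightarrow> real"
  where "intersection_density \<Omega> G =
    Max {real (card \<F>) / real (card (stabilizer (perm_group \<Omega> G) (\<lambda>g. g) (SOME \<omega>. \<omega> \<in> \<Omega>))) | \<F>.
           \<F> \<subseteq> G \<and> intersecting \<Omega> \<F>}"

lemma card_stabilizer_eq:
  assumes fin: "finite \<Omega>" and tr: "transitive_perm_group \<Omega> G"
    and "\<alpha> \<in> \<Omega>" "\<beta> \<in> \<Omega>"
  shows "card (stabilizer (perm_group \<Omega> G) (\<lambda>g. g) \<alpha>) = card (stabilizer (perm_group \<Omega> G) (\<lambda>g. g) \<beta>)"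
proof -
  interpret transitive_action "perm_group \<Omega> G" \<Omega> "\<lambda>g. g"
    using tr by (simp add: transitive_perm_group_def)
  have orb: "orbit (perm_group \<Omega> G) (\<lambda>g. g) x = \<Omega>" if "x \<in> \<Omega>" for x
    using that unique_orbit element_image unfolding orbit_def by fastforce
  have "card \<Omega> * card (stabilizer (perm_group \<Omega> G) (\<lambda>g. g) x) = order (perm_group \<Omega> G)"
    if "x \<in> \<Omega>" for x
    using orbit_stabilizer_theorem[OF that] orb[OF that] by simp
  moreover have "card \<Omega> > 0"
    using fin \<open>\<alpha> \<in> \<Omega>\<close> by (auto simp: card_gt_0_iff)
  ultimately show ?thesis
    using assms(3,4) by (metis nat_mult_eq_cancel1)
qed

lemma intersection_density_eq:
  assumes "finite \<Omega>" "transitive_perm_group \<Omega> G" "\<omega> \<in> \<Omega>"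
  shows "intersection_density \<Omega> G =
    Max {real (card \<F>) / real (card (stabilizer (perm_group \<Omega> G) (\<lambda>g. g) \<omega>)) | \<F>.
           \<F> \<subseteq> G \<and> intersecting \<Omega> \<F>}"
  unfolding intersection_density_def
  using card_stabilizer_eq[OF assms(1,2) someI[of "\<lambda>x. x \<in> \<Omega>"] assms(3)] assms(3) by simp

end

theory Submission
  imports Defs "HOL-Number_Theory.Cong"
begin

text \<open>
  It suffices to find \<open>x \<in> H\<close> with \<open>x\<^sup>q = 1\<close> that acts non-trivially on every block. Such an \<open>x\<close> acts
  as a \<open>q\<close>-cycle on each block. An element \<open>g \<in> G\<close> of order \<open>p\<close> cannot preserve all blocks, since
  their size is \<open>q < p\<close>, so it permutes the \<open>p\<close> blocks in one cycle. Hence the \<open>p q\<close> elements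
  \<open>g\<^sup>j x\<^sup>i\<close> pairwise disagree at every point, and such a set bounds the size of an intersecting set
  by \<open>|G| / (p q) = |G\<^sub>\<omega>|\<close> (\<open>intersection_density_eq_1_of_semiregular\<close>). The group \<open>N\<close> is normal and
  non-trivial, so it is transitive on every block.

  If \<open>N\<close> is abelian, it acts on a block as a cyclic group of order \<open>q\<close> that every \<open>h \<in> H\<close>
  normalizes. So \<open>h\<close> acts as an affine map of \<open>\<int>/q\<close>, and if it has no fixed point there, it is a
  translation and \<open>h\<^sup>q\<close> fixes the block pointwise. A derangement \<open>h \<in> H\<close> can thus serve as \<open>x\<close>
  (\<open>derangement_pow_prime_fixes\<close>).

  If \<open>N\<close> is not abelian, it is perfect by minimality. Write \<open>N\<^sub>S\<close> for the pointwise fixer of a block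
  \<open>S\<close> in \<open>N\<close>. Two normal subgroups of \<open>N\<close> that act non-trivially on a block cannot commute there:
  otherwise both act regularly, \<open>N\<close> acts as a group of affine maps of \<open>\<int>/q\<close>, which is metabelian, and
  being perfect it acts trivially (\<open>derived_derived_fixes\<close>). Taking commutators of fixers, it
  follows that the elements of \<open>N\<close> fixing pointwise all blocks \<open>T\<close> with \<open>N\<^sub>T \<noteq> N\<^sub>S\<close> still
  act non-trivially, and so transitively, on \<open>S\<close>. By Cauchy's theorem one of these elements has
  order \<open>q\<close>; it moves exactly the blocks with the same fixer as \<open>S\<close>. Products of such elements give \<open>x\<close>
  (\<open>exists_prime_order_element_moving_all_blocks\<close>).
\<close>

section \<open>Maps of a set of prime size\<close>

lemma funpow_mem:
  assumes "f \<in> S \<rightarrow> S" "x \<in> S"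
  shows "(f ^^ n) x \<in> S"
  using assms by (induction n) auto

lemma funpow_mult_fixed:
  assumes "(f ^^ n) x = x"
  shows "(f ^^ (n * k)) x = x"
  using assms by (induction k) (auto simp: funpow_add)

lemma funpow_cong_period:
  assumes "(f ^^ q) x = x" "i mod q = j mod q"
  shows "(f ^^ i) x = (f ^^ j) x"
proof -
  have "(f ^^ n) x = (f ^^ (n mod q)) x" for n
  proof -
    have "(f ^^ (n mod q + q * (n div q))) x = (f ^^ (n mod q)) x"
      using funpow_mult_fixed[OF assms(1), of "n div q"] unfolding funpow_add by simp
    then show ?thesis unfolding mod_mult_div_eq .
  qed
  then show ?thesis using assms(2) by metis
qed

lemma funpow_agree:
  assumes "\<And>x. x \<in> S \<Longrightarrow> f x = g x" "g \<in> S \<rightarrow> S" "x \<in> S"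
  shows "(f ^^ n) x = (g ^^ n) x"
  using assms(1,3) funpow_mem[OF assms(2,3)] by (induction n) simp_all

lemma fixed_of_coprime_funpow:
  assumes "(f ^^ i) x = x" "(f ^^ j) x = x" "coprime i j" "i \<noteq> 0"
  shows "f x = x"
proof -
  obtain a b where ab: "i * a = j * b + 1"
    using bezout_nat[OF assms(4), of j] assms(3) by (auto simp: coprime_iff_gcd_eq_1)
  have "(f ^^ (1 + j * b)) x = x"
    using funpow_mult_fixed[OF assms(1), of a] ab by simp
  then show ?thesis
    using funpow_mult_fixed[OF assms(2), of b] by (simp add: funpow_add)
qed

lemma inj_on_prime_period:
  assumes q: "Factorial_Ring.prime (q::nat)" and per: "(f ^^ q) x = x" and mv: "f x \<noteq> x"
  shows "inj_on (\<lambda>i. (f ^^ i) x) {..<q}"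
proof -
  have False if "i < j" "j < q" and eq: "(f ^^ i) x = (f ^^ j) x" for i j
  proof -
    have "(f ^^ (j - i)) x = (f ^^ (j - i + q)) x"
      by (rule funpow_cong_period[OF per]) simp
    also have "j - i + q = q - i + j" using that by simp
    also have "(f ^^ (q - i + j)) x = (f ^^ (q - i)) ((f ^^ j) x)"
      unfolding funpow_add by simp
    also have "\<dots> = (f ^^ (q - i + i)) x"
      by (simp add: eq funpow_add)
    also have "\<dots> = x"
      using that per by simp
    finally have "(f ^^ (j - i)) x = x" .
    moreover have "coprime (j - i) q"
      using q that
      by (metis coprime_commute diff_is_0_eq dvd_imp_le leD less_imp_diff_less not_gr_zero
          prime_imp_coprime)
    ultimately show False
      using fixed_of_coprime_funpow[OF _ per, of "j - i"] mv that(1) by simp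
  qed
  then show ?thesis
    by (intro inj_onI) (metis lessThan_iff linorder_neqE_nat)
qed

lemma prime_period_le_card:
  assumes "Factorial_Ring.prime (q::nat)" "(f ^^ q) x = x" "f x \<noteq> x"
    and "finite S" "f \<in> S \<rightarrow> S" "x \<in> S"
  shows "q \<le> card S"
proof -
  have "(\<lambda>i. (f ^^ i) x) ` {..<q} \<subseteq> S"
    using funpow_mem[OF assms(5,6)] by blast
  from card_mono[OF assms(4) this] show ?thesis
    using card_image[OF inj_on_prime_period[OF assms(1-3)]] by simp
qed

lemma prime_cycle_cover:
  assumes "Factorial_Ring.prime (q::nat)" "(f ^^ q) x = x" "f x \<noteq> x"
    and "finite S" "card S = q" "f \<in> S \<rightarrow> S" "x \<in> S" "y \<in> S"
  shows "\<exists>i<q. y = (f ^^ i) x"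
proof -
  have "(\<lambda>i. (f ^^ i) x) ` {..<q} \<subseteq> S"
    using funpow_mem[OF assms(6,7)] by blast
  then have "(\<lambda>i. (f ^^ i) x) ` {..<q} = S"
  proof (rule card_subset_eq[OF assms(4)])
    show "card ((\<lambda>i. (f ^^ i) x) ` {..<q}) = card S"
      using card_image[OF inj_on_prime_period[OF assms(1-3)]] assms(5) by simp
  qed
  with assms(8) have "y \<in> (\<lambda>i. (f ^^ i) x) ` {..<q}" by (rule back_subst[of "\<lambda>A. y \<in> A", OF _ sym])
  then show ?thesis by blast
qed

lemma prime_cycle_inj_on:
  assumes q: "Factorial_Ring.prime (q::nat)" and per: "\<And>x. x \<in> S \<Longrightarrow> (f ^^ q) x = x"
    and S: "finite S" "card S = q" "f \<in> S \<rightarrow> S"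
    and x: "x \<in> S" "f x \<noteq> x" and y: "y \<in> S"
  shows "inj_on (\<lambda>i. (f ^^ i) y) {..<q}"
proof (rule inj_on_prime_period[OF q per[OF y]])
  show "f y \<noteq> y"
  proof
    assume fix_y: "f y = y"
    have "\<exists>i<q. y = (f ^^ i) x"
      by (rule prime_cycle_cover[OF q per[OF x(1)] x(2) S x(1) y])
    then obtain i where i: "i < q" "y = (f ^^ i) x" by blast
    have "(f ^^ n) y = y" for n
      using fix_y by (induction n) auto
    then have "y = (f ^^ (q - i + i)) x"
      by (simp add: i(2) funpow_add)
    then have "y = x" using i(1) per[OF x(1)] by simp
    then show False using fix_y x(2) by simp
  qed
qed

text \<open>A partition of a set of prime size into parts of equal size \<open>k \<noteq> 1\<close> has only one part.\<close>

lemma equal_classes_prime_card: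
  assumes S: "finite S" "card S = q" "Factorial_Ring.prime (q::nat)"
    and cls: "\<And>x. x \<in> S \<Longrightarrow> x \<in> C x \<and> C x \<subseteq> S \<and> card (C x) = k"
    and disj: "\<And>x y. \<lbrakk>x \<in> S; y \<in> S; C x \<inter> C y \<noteq> {}\<rbrakk> \<Longrightarrow> C x = C y"
    and k: "k \<noteq> 1" and x: "x \<in> S"
  shows "C x = S"
proof -
  have U: "\<Union>(C ` S) = S" using cls by blast
  have "k * card (C ` S) = card (\<Union>(C ` S))"
  proof (rule card_partition)
    show "P \<inter> Q = {}" if "P \<in> C ` S" "Q \<in> C ` S" "P \<noteq> Q" for P Q
      using that disj by (metis imageE)
  qed (use S(1) U cls in auto)
  then have "k dvd q" using U S(2) by (metis dvd_triv_left)
  then have "k = q" using S(3) k by (auto simp: prime_nat_iff)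
  then show ?thesis using cls[OF x] S(1,2) by (metis card_subset_eq)
qed

text \<open>
  If each power of \<open>f\<close> fixes all points of \<open>S\<close> or none, then all cycles of \<open>f\<close> on \<open>S\<close> have the
  same length; when \<open>|S| = q\<close> is prime and \<open>f\<close> is not the identity on \<open>S\<close>, this length is \<open>q\<close>.
\<close>

lemma semiregular_prime_period:
  assumes S: "finite S" "card S = q" "Factorial_Ring.prime (q::nat)" "f \<in> S \<rightarrow> S"
    and per: "n > 0" "\<And>x. x \<in> S \<Longrightarrow> (f ^^ n) x = x"
    and semireg: "\<And>i x y. \<lbrakk>x \<in> S; y \<in> S; (f ^^ i) x = x\<rbrakk> \<Longrightarrow> (f ^^ i) y = y"
    and z: "z \<in> S" "f z \<noteq> z" and x: "x \<in> S"
  shows "(f ^^ q) x = x"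
proof -
  define d where "d = (LEAST n. n > 0 \<and> (\<forall>x\<in>S. (f ^^ n) x = x))"
  have d: "d > 0 \<and> (\<forall>x\<in>S. (f ^^ d) x = x)"
    unfolding d_def by (rule LeastI[of _ n]) (use per in auto)
  have min: "\<not> (m > 0 \<and> (\<forall>x\<in>S. (f ^^ m) x = x))" if "m < d" for m
    using not_less_Least that unfolding d_def by blast
  \<comment> \<open>The cycle of \<open>x\<close>; since \<open>f\<^sup>d\<close> is the identity on \<open>S\<close>, non-negative powers suffice.\<close>
  define C where "C x = range (\<lambda>i. (f ^^ i) x)" for x
  have C_eq: "C x = (\<lambda>i. (f ^^ i) x) ` {..<d}" if "x \<in> S" for x
  proof -
    have "(f ^^ i) x = (f ^^ (i mod d)) x" for i
      using funpow_cong_period[of d f x i "i mod d"] d that by simp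
    then show ?thesis unfolding C_def using d by fastforce
  qed
  have inj: "inj_on (\<lambda>i. (f ^^ i) x) {..<d}" if "x \<in> S" for x
  proof -
    have False if "i < j" "j < d" and eq: "(f ^^ i) x = (f ^^ j) x" for i j
    proof -
      have "(f ^^ (j - i)) x = (f ^^ (j - i + d)) x"
        by (rule funpow_cong_period[of d]) (use d \<open>x \<in> S\<close> in auto)
      also have "j - i + d = d - i + j" using that by simp
      also have "(f ^^ (d - i + j)) x = (f ^^ (d - i)) ((f ^^ j) x)"
        unfolding funpow_add by simp
      also have "\<dots> = (f ^^ (d - i + i)) x"
        by (simp add: eq funpow_add)
      also have "\<dots> = x"
        using that d \<open>x \<in> S\<close> by simp
      finally have "(f ^^ (j - i)) x = x" .
      moreover have "j - i < d" "j - i > 0" using that(1,2) by linarith+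
      ultimately show False
        using min[of "j - i"] semireg[OF \<open>x \<in> S\<close>] by blast
    qed
    then show ?thesis
      by (intro inj_onI) (metis lessThan_iff linorder_neqE_nat)
  qed
  have card_C: "card (C x) = d" if "x \<in> S" for x
    using C_eq[OF that] card_image[OF inj[OF that]] by simp
  have shift: "C ((f ^^ i) x) = C x" if "x \<in> S" for i x
  proof
    show "C ((f ^^ i) x) \<subseteq> C x"
      unfolding C_def by (auto simp flip: funpow_add[THEN fun_cong, unfolded o_apply])
    have "(f ^^ j) x = (f ^^ (j + (d * i - i))) ((f ^^ i) x)" for j
    proof -
      have "i \<le> d * i" using d by simp
      then have "j + (d * i - i) + i = j + d * i" by linarith
      then have "(f ^^ (j + (d * i - i))) ((f ^^ i) x) = (f ^^ (j + d * i)) x"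
        by (simp only: funpow_add[THEN fun_cong, unfolded o_apply, symmetric])
      also have "\<dots> = (f ^^ j) x"
        by (rule funpow_cong_period[of d]) (use d that in auto)
      finally show ?thesis by simp
    qed
    then show "C x \<subseteq> C ((f ^^ i) x)"
      unfolding C_def by blast
  qed
  have "d \<noteq> 1" using d z by auto
  have "C x = S"
  proof (rule equal_classes_prime_card[OF S(1-3) _ _ \<open>d \<noteq> 1\<close> x])
    fix x assume "x \<in> S"
    then show "x \<in> C x \<and> C x \<subseteq> S \<and> card (C x) = d"
      using funpow_mem[OF S(4)] card_C unfolding C_def
      by (auto intro: range_eqI[of _ _ 0])
  next
    fix x y assume xy: "x \<in> S" "y \<in> S" "C x \<inter> C y \<noteq> {}"
    then obtain i j where "(f ^^ i) x = (f ^^ j) y" unfolding C_def by auto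
    then show "C x = C y" using shift xy(1,2) by metis
  qed
  then have "d = q" using card_C[OF x] S(2) by simp
  then show ?thesis using d x by simp
qed

text \<open>
  Identify \<open>S\<close> with \<open>\<int>/q\<close> so that \<open>c\<close> becomes the translation by one. A map \<open>h\<close> with
  \<open>h c = c\<^sup>k h\<close> is then affine with slope \<open>k\<close>; without fixed points it has to be a translation.
\<close>

lemma fixed_point_free_affine_period:
  assumes q: "Factorial_Ring.prime (q::nat)"
    and S: "finite S" "card S = q" "c \<in> S \<rightarrow> S"
    and per: "\<And>x. x \<in> S \<Longrightarrow> (c ^^ q) x = x" and z: "z \<in> S" "c z \<noteq> z"
    and h: "h \<in> S \<rightarrow> S" "\<And>x. x \<in> S \<Longrightarrow> h (c x) = (c ^^ k) (h x)"
    and free: "\<And>x. x \<in> S \<Longrightarrow> h x \<noteq> x" and x: "x \<in> S"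
  shows "(h ^^ q) x = x"
proof -
  have cover: "\<exists>j<q. y = (c ^^ j) z" if "y \<in> S" for y
    by (rule prime_cycle_cover[OF q per[OF z(1)] z(2) S z(1) that])
  obtain b where b: "h z = (c ^^ b) z"
    using cover[of "h z"] h(1) z(1) by blast
  have aff: "h ((c ^^ j) z) = (c ^^ (k * j + b)) z" for j
  proof (induction j)
    case (Suc j)
    have "h ((c ^^ Suc j) z) = (c ^^ k) ((c ^^ (k * j + b)) z)"
      using h(2)[OF funpow_mem[OF S(3) z(1)]] Suc by simp
    also have "\<dots> = (c ^^ (k + (k * j + b))) z" unfolding funpow_add by simp
    also have "k + (k * j + b) = k * Suc j + b" by simp
    finally show ?case .
  qed (simp add: b)
  \<comment> \<open>Otherwise \<open>k j + b = j\<close> is solvable modulo \<open>q\<close>, and \<open>c\<^sup>j z\<close> is a fixed point of \<open>h\<close>.\<close>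
  have "k mod q = 1 mod q"
  proof (rule ccontr)
    assume "k mod q \<noteq> 1 mod q"
    then have "\<not> int q dvd int k - 1"
      using cong_int_iff[of k 1 q] by (simp add: cong_def flip: cong_iff_dvd_diff)
    then have "coprime (int k - 1) (int q)"
      using prime_imp_coprime[of "int q" "int k - 1"] q by (simp add: coprime_commute)
    then obtain u where u: "[(int k - 1) * u = 1] (mod int q)"
      using cong_solve_coprime_int by blast
    define j where "j = nat ((- u * int b) mod int q)"
    have q0: "int q > 0" using q by (simp add: prime_gt_0_nat)
    have j: "[int j = - u * int b] (mod int q)"
      unfolding j_def using q0 by (simp add: cong_def)
    have "[(int k - 1) * int j + int b = (int k - 1) * (- u * int b) + int b] (mod int q)"
      by (intro cong_add cong_mult j cong_refl)
    also have "(int k - 1) * (- u * int b) + int b = - ((int k - 1) * u) * int b + int b"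
      by (simp add: algebra_simps)
    also have "[\<dots> = - 1 * int b + int b] (mod int q)"
      using u by (intro cong_add cong_mult cong_refl) (simp only: cong_minus_minus_iff)
    finally have "[int (k * j + b) = int j] (mod int q)"
      by (simp add: cong_iff_dvd_diff algebra_simps)
    then have "(k * j + b) mod q = j mod q"
      by (metis cong_int_iff cong_def)
    then have "(c ^^ (k * j + b)) z = (c ^^ j) z"
      by (rule funpow_cong_period[OF per[OF z(1)]])
    then have "h ((c ^^ j) z) = (c ^^ j) z" using aff by simp
    then show False using free[OF funpow_mem[OF S(3) z(1)]] by blast
  qed
  have tr: "h y = (c ^^ b) y" if "y \<in> S" for y
  proof -
    obtain j where j: "y = (c ^^ j) z" using cover \<open>y \<in> S\<close> by blast
    have "(k * j + b) mod q = (b + j) mod q"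
      using cong_add[OF cong_refl cong_mult[OF _ cong_refl], of k 1 q b j] \<open>k mod q = 1 mod q\<close>
      by (simp add: cong_def add.commute)
    then have "(c ^^ (k * j + b)) z = (c ^^ (b + j)) z"
      by (rule funpow_cong_period[OF per[OF z(1)]])
    then show ?thesis using aff j by (simp add: funpow_add)
  qed
  have "(h ^^ q) x = ((c ^^ b) ^^ q) x"
    by (rule funpow_agree[of S]) (use tr x funpow_mem[OF S(3)] in auto)
  also have "\<dots> = (c ^^ (q * b)) x" by (simp add: funpow_mult mult.commute)
  also have "\<dots> = x" by (rule funpow_mult_fixed[OF per[OF x]])
  finally show ?thesis .
qed

section \<open>Finite group actions\<close>

lemma (in group) subgroup_nat_pow_closed:
  assumes "subgroup A G" "a \<in> A"
  shows "a [^] (n::nat) \<in> A"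
  using assms by (induction n) (auto simp: subgroup.one_closed subgroup.m_closed)

lemma (in group) exists_element_of_prime_order:
  assumes A: "subgroup A G" "finite A" and q: "Factorial_Ring.prime (q::nat)" "q dvd card A"
  shows "\<exists>a\<in>A. a \<noteq> \<one> \<and> a [^] q = \<one>"
proof -
  have "order (G\<lparr>carrier := A\<rparr>) = q ^ 1 * (card A div q)"
    using q by (simp add: order_def)
  then obtain P where P: "subgroup P (G\<lparr>carrier := A\<rparr>)" "card P = q"
    using sylow_thm[OF q(1) subgroup.subgroup_is_group[OF A(1) is_group], of 1] A(2) by auto
  have sub: "subgroup P G" using incl_subgroup[OF A(1) P(1)] .
  have PA: "P \<subseteq> A" using subgroup.subset[OF P(1)] by simp
  have fin: "finite P" using PA A(2) finite_subset by blast
  have "\<not> P \<subseteq> {\<one>}"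
  proof
    assume "P \<subseteq> {\<one>}"
    then have "card P \<le> card {\<one>}" by (intro card_mono) auto
    then show False using P(2) prime_gt_1_nat[OF q(1)] by simp
  qed
  then obtain a where a: "a \<in> P" "a \<noteq> \<one>" by blast
  interpret P: group "G\<lparr>carrier := P\<rparr>" using subgroup.subgroup_is_group[OF sub is_group] .
  have "a [^]\<^bsub>G\<lparr>carrier := P\<rparr>\<^esub> order (G\<lparr>carrier := P\<rparr>) = \<one>"
    using P.pow_order_eq_1 a(1) by simp
  then have "a [^] q = \<one>" using P(2) by (simp add: order_def flip: nat_pow_consistent)
  then show ?thesis using a PA by blast
qed

locale finite_group_action = group_action G E \<phi> + group G
  for G (structure) and E and \<phi> +
  assumes finite_carrier: "finite (carrier G)"
begin

text \<open>
  Any two points of \<open>S\<close> are joined by an element of \<open>A\<close>; it is not required that \<open>A\<close> preserves \<open>S\<close>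
  or is a subgroup.
\<close>

definition transitive_on :: "'a set \<Rightarrow> 'c set \<Rightarrow> bool"
  where "transitive_on A S \<longleftrightarrow> (\<forall>x\<in>S. \<forall>y\<in>S. \<exists>a\<in>A. \<phi> a x = y)"

text \<open>The image of \<open>A\<close> in \<open>Sym(S)\<close> is semiregular; \<open>A\<close> itself may have a kernel on \<open>S\<close>.\<close>

definition semiregular_on :: "'a set \<Rightarrow> 'c set \<Rightarrow> bool"
  where "semiregular_on A S \<longleftrightarrow> (\<forall>a\<in>A. \<forall>x\<in>S. \<forall>y\<in>S. \<phi> a x = x \<longrightarrow> \<phi> a y = y)"

text \<open>The elements of \<open>M\<close> fixing every point of \<open>S\<close>; the fixer of the empty set is \<open>M\<close>.\<close>

definition pointwise_fixer :: "'a set \<Rightarrow> 'c set \<Rightarrow> 'a set"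
  where "pointwise_fixer M S = {m \<in> M. \<forall>x\<in>S. \<phi> m x = x}"

lemma transitive_onE:
  assumes "transitive_on A S" "x \<in> S" "y \<in> S"
  obtains a where "a \<in> A" "\<phi> a x = y"
  using assms unfolding transitive_on_def by blast

lemma action_closed: "\<lbrakk>g \<in> carrier G; x \<in> E\<rbrakk> \<Longrightarrow> \<phi> g x \<in> E"
  using element_image by blast

lemma one_apply: "x \<in> E \<Longrightarrow> \<phi> \<one> x = x"
  by (simp flip: id_eq_one)

lemma inv_apply: "\<lbrakk>g \<in> carrier G; x \<in> E\<rbrakk> \<Longrightarrow> \<phi> (inv g) (\<phi> g x) = x"
  using orbit_sym_aux by blast

lemma apply_inv: "\<lbrakk>g \<in> carrier G; x \<in> E\<rbrakk> \<Longrightarrow> \<phi> g (\<phi> (inv g) x) = x"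
  using orbit_sym_aux[of "inv g" x] by simp

lemma pow_apply:
  assumes "g \<in> carrier G" "x \<in> E"
  shows "\<phi> (g [^] n) x = (\<phi> g ^^ n) x"
  using assms(2)
proof (induction n arbitrary: x)
  case 0
  then show ?case by (simp add: one_apply)
next
  case (Suc n)
  then show ?case
    using assms(1) by (simp add: composition_rule action_closed funpow_swap1)
qed

lemma conj_apply:
  assumes "g \<in> carrier G" "a \<in> carrier G" "x \<in> E"
  shows "\<phi> (g \<otimes> a \<otimes> inv g) (\<phi> g x) = \<phi> g (\<phi> a x)"
  using assms by (simp add: composition_rule action_closed inv_apply)

lemma commutator_apply:
  assumes "g \<in> carrier G" "h \<in> carrier G" "x \<in> E"
  shows "\<phi> (g \<otimes> h \<otimes> inv g \<otimes> inv h) (\<phi> h (\<phi> g x)) = \<phi> g (\<phi> h x)"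
  using assms by (simp add: composition_rule action_closed inv_apply)

lemma subgroup_pointwise_fixer:
  assumes M: "subgroup M G" and S: "S \<subseteq> E"
  shows "subgroup (pointwise_fixer M S) G"
proof -
  have M': "M \<subseteq> carrier G" using subgroup.subset[OF M] .
  have "inv g \<in> pointwise_fixer M S" if "g \<in> pointwise_fixer M S" for g
  proof -
    have "\<phi> (inv g) x = x" if "x \<in> S" for x
    proof -
      have "g \<in> carrier G" "\<phi> g x = x" "x \<in> E"
        using \<open>g \<in> pointwise_fixer M S\<close> M' S that by (auto simp: pointwise_fixer_def)
      then show ?thesis using inv_apply[of g x] by simp
    qed
    then show ?thesis using that subgroup.m_inv_closed[OF M] by (auto simp: pointwise_fixer_def)
  qed
  moreover have "g \<otimes> h \<in> pointwise_fixer M S"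
    if "g \<in> pointwise_fixer M S" "h \<in> pointwise_fixer M S" for g h
  proof -
    have gh: "g \<in> M" "h \<in> M" using that by (auto simp: pointwise_fixer_def)
    have "\<phi> (g \<otimes> h) x = x" if "x \<in> S" for x
    proof -
      have "\<phi> g x = x" "\<phi> h x = x"
        using that \<open>g \<in> pointwise_fixer M S\<close> \<open>h \<in> pointwise_fixer M S\<close>
        by (auto simp: pointwise_fixer_def)
      moreover have "x \<in> E" "g \<in> carrier G" "h \<in> carrier G" using gh M' S that by auto
      ultimately show ?thesis by (simp add: composition_rule)
    qed
    then show ?thesis using gh subgroup.m_closed[OF M] by (auto simp: pointwise_fixer_def)
  qed
  moreover have "\<one> \<in> pointwise_fixer M S"
    using S one_apply subgroup.one_closed[OF M] by (auto simp: pointwise_fixer_def)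
  ultimately show ?thesis
    using M' by (intro subgroupI) (auto simp: pointwise_fixer_def)
qed

lemma pointwise_fixer_conj:
  assumes "g \<in> carrier G" "M \<subseteq> carrier G" "S \<subseteq> E" "a \<in> pointwise_fixer M S" "g \<otimes> a \<otimes> inv g \<in> M"
  shows "g \<otimes> a \<otimes> inv g \<in> pointwise_fixer M (\<phi> g ` S)"
proof -
  have "\<phi> (g \<otimes> a \<otimes> inv g) (\<phi> g x) = \<phi> g x" if "x \<in> S" for x
  proof -
    have "a \<in> carrier G" "\<phi> a x = x" "x \<in> E" using assms that by (auto simp: pointwise_fixer_def)
    then show ?thesis using conj_apply[OF assms(1)] by simp
  qed
  then show ?thesis using assms(5) by (auto simp: pointwise_fixer_def)
qed

lemma image_eq_of_subgroup:
  assumes M: "subgroup M G" "\<And>m. m \<in> M \<Longrightarrow> \<phi> m \<in> S \<rightarrow> S" and S: "S \<subseteq> E" and m: "m \<in> M"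
  shows "\<phi> m ` S = S"
proof
  show "\<phi> m ` S \<subseteq> S" using M(2)[OF m] by blast
  show "S \<subseteq> \<phi> m ` S"
  proof
    fix x assume x: "x \<in> S"
    have "\<phi> (inv m) x \<in> S" using M(2)[OF subgroup.m_inv_closed[OF M(1) m]] x by blast
    moreover have "\<phi> m (\<phi> (inv m) x) = x"
      using apply_inv[of m x] x S m subgroup.subset[OF M(1)] by blast
    ultimately show "x \<in> \<phi> m ` S" by force
  qed
qed

lemma card_dvd_of_transitive:
  assumes A: "subgroup A G" "\<And>a. a \<in> A \<Longrightarrow> \<phi> a \<in> S \<rightarrow> S" "transitive_on A S"
    and S: "S \<subseteq> E" "x \<in> S"
  shows "card S dvd card A"
proof -
  interpret A: group_action "G\<lparr>carrier := A\<rparr>" E \<phi>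
    using induced_action[OF A(1)] .
  have "\<exists>a\<in>A. \<phi> a x = y" if "y \<in> S" for y
    using transitive_onE[OF A(3) S(2) that] by metis
  then have "orbit (G\<lparr>carrier := A\<rparr>) \<phi> x = S"
    using A(2) S(2) unfolding orbit_def by fastforce
  then show ?thesis
    using A.orbit_stabilizer_theorem[of x] S by (intro dvdI[OF sym]) (auto simp: order_def)
qed

text \<open>
  The orbits on \<open>S\<close> of a subgroup \<open>A\<close> that is normalized by a transitive set \<open>M\<close> have equal size.
  The elements of \<open>M\<close> need not preserve \<open>S\<close>.
\<close>

lemma transitive_on_of_normalized:
  assumes S: "S \<subseteq> E" "finite S" "card S = q" "Factorial_Ring.prime (q::nat)"
    and A: "subgroup A G" "\<And>a. a \<in> A \<Longrightarrow> \<phi> a \<in> S \<rightarrow> S"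
    and M: "M \<subseteq> carrier G" "transitive_on M S" "\<And>m a. \<lbrakk>m \<in> M; a \<in> A\<rbrakk> \<Longrightarrow> m \<otimes> a \<otimes> inv m \<in> A"
    and mv: "a \<in> A" "x \<in> S" "\<phi> a x \<noteq> x"
  shows "transitive_on A S"
proof -
  define Orb where "Orb y = (\<lambda>a. \<phi> a y) ` A" for y
  have A': "a \<in> carrier G" if "a \<in> A" for a using subgroup.mem_carrier[OF A(1)] that .
  have self: "y \<in> Orb y" if "y \<in> S" for y
    using one_apply[of y] that S(1) subgroup.one_closed[OF A(1)] unfolding Orb_def by force
  have sub: "Orb y \<subseteq> S" if "y \<in> S" for y
    using A(2) that unfolding Orb_def by blast
  have fin: "finite (Orb y)" if "y \<in> S" for y
    using finite_subset[OF sub[OF that] S(2)] .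
  have le: "card (Orb y) \<le> card (Orb z)" if yz: "y \<in> S" "z \<in> S" for y z
  proof -
    obtain m where m: "m \<in> M" "\<phi> m y = z" using transitive_onE[OF M(2) yz] .
    have mc: "m \<in> carrier G" using m(1) M(1) by blast
    have "\<phi> m (\<phi> b y) \<in> Orb z" if "b \<in> A" for b
    proof -
      have "\<phi> (m \<otimes> b \<otimes> inv m) z = \<phi> m (\<phi> b y)"
        using conj_apply[OF mc A'[OF that], of y] m(2) yz(1) S(1) by auto
      then show ?thesis using M(3)[OF m(1) that] unfolding Orb_def by (metis imageI)
    qed
    then have "\<phi> m ` Orb y \<subseteq> Orb z" unfolding Orb_def by blast
    moreover have "inj_on (\<phi> m) (Orb y)"
      using inj_on_subset[OF inj_prop[OF mc]] sub[OF yz(1)] S(1) by blast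
    ultimately show ?thesis using card_inj_on_le fin[OF yz(2)] by blast
  qed
  have sub_Orb: "Orb y \<subseteq> Orb z" if yz: "y \<in> S" "z \<in> S" "Orb y \<inter> Orb z \<noteq> {}" for y z
  proof
    obtain a b where ab: "a \<in> A" "b \<in> A" "\<phi> a y = \<phi> b z"
      using yz(3) unfolding Orb_def by auto
    have yzE: "y \<in> E" "z \<in> E" using yz S(1) by auto
    fix w assume "w \<in> Orb y"
    then obtain c where c: "c \<in> A" "w = \<phi> c y" unfolding Orb_def by blast
    have "\<phi> (c \<otimes> inv a \<otimes> b) z = \<phi> c (\<phi> (inv a) (\<phi> a y))"
      using A' ab c yzE by (simp add: composition_rule action_closed)
    also have "\<dots> = w" using inv_apply[OF A'[OF ab(1)] yzE(1)] c(2) by simp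
    finally have w: "\<phi> (c \<otimes> inv a \<otimes> b) z = w" .
    have "c \<otimes> inv a \<otimes> b \<in> A"
      using ab c A(1) by (intro subgroup.m_closed[OF A(1)] subgroup.m_inv_closed[OF A(1)])
    then show "w \<in> Orb z" unfolding Orb_def using w by (metis imageI)
  qed
  have "card (Orb x) \<noteq> 1"
  proof
    assume "card (Orb x) = 1"
    then obtain w where "Orb x = {w}" by (auto simp: card_1_singleton_iff)
    moreover have "\<phi> a x \<in> Orb x" using mv(1) unfolding Orb_def by blast
    ultimately show False using self[OF mv(2)] mv(3) by simp
  qed
  have "Orb y = S" if "y \<in> S" for y
  proof (rule equal_classes_prime_card[OF S(2-4) _ _ \<open>card (Orb x) \<noteq> 1\<close> that])
    show "z \<in> Orb z \<and> Orb z \<subseteq> S \<and> card (Orb z) = card (Orb x)" if "z \<in> S" for z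
      using self sub le that mv(2) by (simp add: antisym)
    show "Orb w = Orb z" if "w \<in> S" "z \<in> S" "Orb w \<inter> Orb z \<noteq> {}" for w z
      using sub_Orb[of w z] sub_Orb[of z w] that by blast
  qed
  then show ?thesis unfolding transitive_on_def Orb_def by blast
qed

lemma exists_moved_of_transitive_on:
  assumes "transitive_on A S" "finite S" "card S > 1"
  shows "\<exists>a\<in>A. \<exists>x\<in>S. \<phi> a x \<noteq> x"
proof -
  obtain x where x: "x \<in> S" using assms(3) by fastforce
  moreover have "\<not> S \<subseteq> {x}"
    using card_mono[of "{x}" S] assms(3) by auto
  ultimately obtain y where "y \<in> S" "y \<noteq> x" by blast
  then show ?thesis using x by (metis transitive_onE[OF assms(1)])
qed

lemma funpow_semiconj:
  assumes "\<forall>x\<in>S. f (h x) = h ((f ^^ l) x)" "f \<in> S \<rightarrow> S" "x \<in> S"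
  shows "(f ^^ k) (h x) = h ((f ^^ (l * k)) x)"
proof (induction k)
  case (Suc k)
  have "(f ^^ Suc k) (h x) = h ((f ^^ l) ((f ^^ (l * k)) x))"
    using Suc bspec[OF assms(1) funpow_mem[OF assms(2,3)]] by simp
  also have "(f ^^ l) ((f ^^ (l * k)) x) = (f ^^ (l + l * k)) x"
    unfolding funpow_add by simp
  finally show ?case by simp
qed simp

text \<open>
  A group that is semiregular on a set of prime size acts there as the group of powers of any
  element \<open>c\<close> that is not the identity on this set.
\<close>

lemma semiregular_prime_cyclic:
  assumes S: "S \<subseteq> E" "finite S" "card S = q" "Factorial_Ring.prime (q::nat)"
    and A: "subgroup A G" "\<forall>a\<in>A. \<phi> a \<in> S \<rightarrow> S" "semiregular_on A S"
    and c: "c \<in> A" "z \<in> S" "\<phi> c z \<noteq> z"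
  shows "\<forall>x\<in>S. (\<phi> c ^^ q) x = x"
    and "\<forall>a\<in>A. \<exists>k. \<forall>x\<in>S. \<phi> a x = (\<phi> c ^^ k) x"
proof -
  have semireg: "\<phi> a y = y" if "a \<in> A" "x \<in> S" "y \<in> S" "\<phi> a x = x" for a x y
    using A(3) that unfolding semiregular_on_def by blast
  have Ac: "a \<in> carrier G" if "a \<in> A" for a using subgroup.mem_carrier[OF A(1) that] .
  have SE: "x \<in> E" if "x \<in> S" for x using that S(1) by blast
  have pow: "(\<phi> c ^^ i) x = \<phi> (c [^] i) x" if "x \<in> S" for i x
    using pow_apply[OF Ac[OF c(1)]] SE that by simp
  have c_pow: "c [^] i \<in> A" for i :: nat using subgroup_nat_pow_closed[OF A(1) c(1)] .
  have per: "(\<phi> c ^^ q) x = x" if "x \<in> S" for x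
  proof (rule semiregular_prime_period[OF S(2-4) bspec[OF A(2) c(1)] _ _ _ c(2,3) that])
    show "order G > 0" using finite_carrier by (simp add: order_gt_0_iff_finite)
    show "(\<phi> c ^^ order G) x = x" if "x \<in> S" for x
      using pow[OF that] pow_order_eq_1[OF Ac[OF c(1)]] one_apply SE[OF that] by simp
    show "(\<phi> c ^^ i) y = y" if "x \<in> S" "y \<in> S" "(\<phi> c ^^ i) x = x" for i x y
      using semireg[OF c_pow that(1,2)] pow that by simp
  qed
  then show "\<forall>x\<in>S. (\<phi> c ^^ q) x = x" by blast
  show "\<forall>a\<in>A. \<exists>k. \<forall>x\<in>S. \<phi> a x = (\<phi> c ^^ k) x"
  proof
    fix a assume a: "a \<in> A"
    have "\<phi> a z \<in> S" using A(2) a c(2) by blast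
    then obtain k where k: "\<phi> a z = (\<phi> c ^^ k) z"
      using prime_cycle_cover[OF S(4) per[OF c(2)] c(3) S(2,3) bspec[OF A(2) c(1)] c(2)] by blast
    have "\<phi> a y = (\<phi> c ^^ k) y" if y: "y \<in> S" for y
    proof -
      define b where "b = c [^] k"
      have b: "b \<in> A" "b \<in> carrier G" "\<phi> a z = \<phi> b z"
        using c_pow Ac k pow[OF c(2)] by (auto simp: b_def)
      have "\<phi> (inv b \<otimes> a) z = z"
        using b Ac[OF a] SE[OF c(2)] by (simp add: composition_rule inv_apply)
      then have "\<phi> (inv b \<otimes> a) y = y"
        using semireg[OF _ c(2) y] a b(1) subgroup.m_closed[OF A(1) subgroup.m_inv_closed[OF A(1)]]
        by blast
      then have "\<phi> b (\<phi> (inv b) (\<phi> a y)) = \<phi> b y"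
        using Ac[OF a] b(2) SE[OF y] by (simp add: composition_rule)
      then show ?thesis
        using Ac[OF a] b(2) apply_inv action_closed SE[OF y] pow[OF y] by (simp add: b_def)
    qed
    then show "\<exists>k. \<forall>x\<in>S. \<phi> a x = (\<phi> c ^^ k) x" by blast
  qed
qed

text \<open>
  Let \<open>A\<close> and \<open>B\<close> be normal subgroups of \<open>N\<close> that commute on \<open>S\<close>, both non-trivial there. Both
  are transitive, so \<open>A\<close> is semiregular, and some \<open>c \<in> A\<close> acts as a \<open>q\<close>-cycle that every
  element of \<open>N\<close> conjugates, on \<open>S\<close>, to a power of itself. Hence commutators of \<open>N\<close> commute with \<open>c\<close>,
  which makes them act as powers of \<open>c\<close>, and the second derived subgroup of \<open>N\<close> acts trivially.
\<close>

lemma derived_derived_fixes: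
  assumes S: "S \<subseteq> E" "finite S" "card S = q" "Factorial_Ring.prime (q::nat)"
    and N: "subgroup N G" "\<And>n. n \<in> N \<Longrightarrow> \<phi> n \<in> S \<rightarrow> S" "transitive_on N S"
    and A: "subgroup A G" "A \<subseteq> N" "\<And>n a. \<lbrakk>n \<in> N; a \<in> A\<rbrakk> \<Longrightarrow> n \<otimes> a \<otimes> inv n \<in> A"
    and B: "subgroup B G" "B \<subseteq> N" "\<And>n b. \<lbrakk>n \<in> N; b \<in> B\<rbrakk> \<Longrightarrow> n \<otimes> b \<otimes> inv n \<in> B"
    and A_moves: "a0 \<in> A" "x0 \<in> S" "\<phi> a0 x0 \<noteq> x0"
    and B_moves: "b0 \<in> B" "y0 \<in> S" "\<phi> b0 y0 \<noteq> y0"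
    and comm: "\<And>a b x. \<lbrakk>a \<in> A; b \<in> B; x \<in> S\<rbrakk> \<Longrightarrow> \<phi> a (\<phi> b x) = \<phi> b (\<phi> a x)"
  shows "derived G (derived G N) \<subseteq> pointwise_fixer N S"
proof -
  have Nc: "n \<in> carrier G" if "n \<in> N" for n using subgroup.mem_carrier[OF N(1) that] .
  have SE: "x \<in> E" if "x \<in> S" for x using that S(1) by blast
  have closed: "\<phi> n x \<in> S" if "n \<in> N" "x \<in> S" for n x using N(2) that by blast
  have trB: "transitive_on B S"
    by (rule transitive_on_of_normalized[OF S B(1) _ _ N(3) B(3) B_moves]) (use B(2) N(2) Nc in blast)+
  have semireg: "semiregular_on A S"
    unfolding semiregular_on_def
  proof (intro ballI impI)
    fix a x y assume a: "a \<in> A" "x \<in> S" "y \<in> S" "\<phi> a x = x"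
    show "\<phi> a y = y" using transitive_onE[OF trB a(2,3)] comm a by metis
  qed
  define c where "c = a0"
  define f where "f = \<phi> c"
  have c: "c \<in> A" "c \<in> N" "c \<in> carrier G" using A_moves(1) A(2) Nc unfolding c_def by auto
  have f: "f \<in> S \<rightarrow> S" unfolding f_def using N(2)[OF c(2)] .
  have z: "x0 \<in> S" "f x0 \<noteq> x0" using A_moves unfolding f_def c_def by auto
  have Apres: "\<forall>a\<in>A. \<phi> a \<in> S \<rightarrow> S" using N(2) A(2) by blast
  note cyc = semiregular_prime_cyclic[OF S A(1) Apres semireg c(1) A_moves(2) A_moves(3)[folded c_def],
      folded f_def]
  have per: "(f ^^ q) x = x" if "x \<in> S" for x
    using cyc(1) that by blast
  have gen: "\<exists>j<q. y = (f ^^ j) x0" if "y \<in> S" for y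
    by (rule prime_cycle_cover[OF S(4) per[OF z(1)] z(2) S(2,3) f z(1) that])
  \<comment> \<open>The conjugate of \<open>c\<close> by \<open>n\<^sup>-\<^sup>1\<close> lies in \<open>A\<close>, so it acts on \<open>S\<close> as some power \<open>c\<^sup>k\<close>.\<close>
  have conj: "\<exists>k. \<forall>x\<in>S. f (\<phi> n x) = \<phi> n ((f ^^ k) x)" if n: "n \<in> N" for n
  proof -
    define a where "a = inv n \<otimes> c \<otimes> n"
    have a: "a \<in> A" using A(3)[OF subgroup.m_inv_closed[OF N(1) n] c(1)] Nc[OF n] by (simp add: a_def)
    obtain k where k: "\<forall>x\<in>S. \<phi> a x = (f ^^ k) x" using cyc(2) a by blast
    have "f (\<phi> n x) = \<phi> n ((f ^^ k) x)" if x: "x \<in> S" for x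
    proof -
      have "\<phi> a x = (f ^^ k) x" using k x by blast
      moreover have "\<phi> n (\<phi> a x) = f (\<phi> n x)"
        unfolding a_def f_def using Nc[OF n] c(3) SE[OF x]
        by (simp add: composition_rule action_closed apply_inv)
      ultimately show ?thesis by simp
    qed
    then show ?thesis by blast
  qed
  \<comment> \<open>The elements of \<open>N\<close> that commute with \<open>c\<close> on \<open>S\<close>.\<close>
  define T where "T = {n \<in> N. \<forall>x\<in>S. \<phi> n (f x) = f (\<phi> n x)}"
  have fS: "f x \<in> S" if "x \<in> S" for x using f that by blast
  have T: "subgroup T G"
  proof (rule subgroupI)
    show "T \<subseteq> carrier G" using Nc unfolding T_def by blast
    show "T \<noteq> {}"
      unfolding T_def using subgroup.one_closed[OF N(1)] one_apply SE fS by auto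
    show "inv n \<in> T" if n: "n \<in> T" for n
    proof -
      have nN: "n \<in> N" "inv n \<in> N" using n subgroup.m_inv_closed[OF N(1)] by (auto simp: T_def)
      have "\<phi> (inv n) (f x) = f (\<phi> (inv n) x)" if x: "x \<in> S" for x
      proof -
        define y where "y = \<phi> (inv n) x"
        have y: "y \<in> S" "x = \<phi> n y"
          using closed[OF nN(2) x] apply_inv[OF Nc[OF nN(1)] SE[OF x]] by (auto simp: y_def)
        have "f x = \<phi> n (f y)" using n y by (auto simp: T_def)
        then show ?thesis using inv_apply[OF Nc[OF nN(1)] SE[OF fS[OF y(1)]]] y_def by simp
      qed
      then show ?thesis using nN by (auto simp: T_def)
    qed
    show "n \<otimes> m \<in> T" if nm: "n \<in> T" "m \<in> T" for n m
    proof -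
      have N': "n \<in> N" "m \<in> N" "n \<otimes> m \<in> N"
        using nm subgroup.m_closed[OF N(1)] by (auto simp: T_def)
      have "\<phi> (n \<otimes> m) (f x) = f (\<phi> (n \<otimes> m) x)" if x: "x \<in> S" for x
        using nm x closed[OF N'(2) x] Nc N' SE fS by (simp add: T_def composition_rule)
      then show ?thesis using N' by (auto simp: T_def)
    qed
  qed
  \<comment> \<open>Every point of \<open>S\<close> has the form \<open>m n y\<close>, which is where commutators are evaluated.\<close>
  have split: "\<exists>y\<in>S. x = \<phi> m (\<phi> n y)" if nm: "n \<in> N" "m \<in> N" and x: "x \<in> S" for n m x
  proof
    have m': "\<phi> (inv m) x \<in> S" using closed[OF subgroup.m_inv_closed[OF N(1) nm(2)] x] .
    show "\<phi> (inv n) (\<phi> (inv m) x) \<in> S" using closed[OF subgroup.m_inv_closed[OF N(1) nm(1)] m'] .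
    show "x = \<phi> m (\<phi> n (\<phi> (inv n) (\<phi> (inv m) x)))"
      using nm Nc SE[OF x] SE[OF m'] by (simp add: apply_inv)
  qed
  have "derived_set G N \<subseteq> T"
  proof clarify
    fix n m assume nm: "n \<in> N" "m \<in> N"
    let ?t = "n \<otimes> m \<otimes> inv n \<otimes> inv m"
    have t: "?t \<in> N" using nm by (intro subgroup.m_closed[OF N(1)] subgroup.m_inv_closed[OF N(1)])
    obtain k where k: "\<forall>x\<in>S. f (\<phi> n x) = \<phi> n ((f ^^ k) x)" using conj[OF nm(1)] by blast
    obtain l where l: "\<forall>x\<in>S. f (\<phi> m x) = \<phi> m ((f ^^ l) x)" using conj[OF nm(2)] by blast
    have "\<phi> ?t (f x) = f (\<phi> ?t x)" if x: "x \<in> S" for x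
    proof -
      obtain y where y: "y \<in> S" "x = \<phi> m (\<phi> n y)" using split[OF nm x] by blast
      define w where "w = (f ^^ (k * l)) y"
      have w: "w \<in> S" unfolding w_def using funpow_mem[OF f y(1)] .
      have tc: "\<phi> ?t (\<phi> m (\<phi> n u)) = \<phi> n (\<phi> m u)" if "u \<in> S" for u
        using commutator_apply[OF Nc[OF nm(1)] Nc[OF nm(2)] SE[OF that]] .
      have "f x = \<phi> m ((f ^^ l) (\<phi> n y))" using y l closed[OF nm(1)] by simp
      also have "(f ^^ l) (\<phi> n y) = \<phi> n w"
        unfolding w_def by (rule funpow_semiconj[where h = "\<phi> n", OF k f y(1)])
      finally have "\<phi> ?t (f x) = \<phi> n (\<phi> m w)" using tc[OF w] by simp
      also have "\<phi> m w = (f ^^ k) (\<phi> m y)"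
        unfolding w_def mult.commute[of k l]
        by (rule funpow_semiconj[where h = "\<phi> m", OF l f y(1), symmetric])
      also have "\<phi> n \<dots> = f (\<phi> n (\<phi> m y))" using k closed[OF nm(2) y(1)] by simp
      also have "\<dots> = f (\<phi> ?t x)" using tc[OF y(1)] y(2) by simp
      finally show ?thesis .
    qed
    then show "?t \<in> T" using t unfolding T_def by blast
  qed
  then have derT: "derived G N \<subseteq> T"
    unfolding derived_def by (rule generate_subgroup_incl[OF _ T])
  have pow: "\<exists>k. \<forall>x\<in>S. \<phi> t x = (f ^^ k) x" if t: "t \<in> T" for t
  proof -
    obtain k where k: "\<phi> t x0 = (f ^^ k) x0"
      using gen[of "\<phi> t x0"] closed t z(1) unfolding T_def by blast
    have iter: "\<phi> t ((f ^^ j) x0) = (f ^^ j) (\<phi> t x0)" for j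
    proof (induction j)
      case (Suc j)
      then show ?case using t funpow_mem[OF f z(1)] by (simp add: T_def)
    qed simp
    have "\<phi> t x = (f ^^ k) x" if x: "x \<in> S" for x
    proof -
      obtain j where j: "x = (f ^^ j) x0" using gen[OF x] by blast
      have "\<phi> t x = (f ^^ (j + k)) x0" using iter k j unfolding funpow_add by simp
      also have "\<dots> = (f ^^ k) x" using j by (simp add: add.commute[of j] funpow_add)
      finally show ?thesis .
    qed
    then show ?thesis by blast
  qed
  have "derived_set G (derived G N) \<subseteq> pointwise_fixer N S"
  proof clarify
    fix s t assume "s \<in> derived G N" "t \<in> derived G N"
    then have st: "s \<in> T" "t \<in> T" "s \<in> N" "t \<in> N" using derT unfolding T_def by auto
    let ?u = "s \<otimes> t \<otimes> inv s \<otimes> inv t"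
    have u: "?u \<in> N" using st by (intro subgroup.m_closed[OF N(1)] subgroup.m_inv_closed[OF N(1)])
    obtain k where k: "\<And>x. x \<in> S \<Longrightarrow> \<phi> s x = (f ^^ k) x" using pow[OF st(1)] by blast
    obtain l where l: "\<And>x. x \<in> S \<Longrightarrow> \<phi> t x = (f ^^ l) x" using pow[OF st(2)] by blast
    have "\<phi> ?u x = x" if x: "x \<in> S" for x
    proof -
      obtain y where y: "y \<in> S" "x = \<phi> t (\<phi> s y)" using split[OF st(3,4) x] by blast
      have "\<phi> ?u x = \<phi> s (\<phi> t y)"
        using commutator_apply[OF Nc[OF st(3)] Nc[OF st(4)] SE[OF y(1)]] y(2) by simp
      also have "\<dots> = (f ^^ (k + l)) y" using k l y(1) funpow_mem[OF f y(1)] unfolding funpow_add by simp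
      also have "\<dots> = (f ^^ (l + k)) y" by (simp add: add.commute)
      also have "\<dots> = x" using k l y funpow_mem[OF f y(1)] unfolding funpow_add by simp
      finally show ?thesis .
    qed
    then show "?u \<in> pointwise_fixer N S" using u unfolding pointwise_fixer_def by blast
  qed
  then show ?thesis
    unfolding derived_def[of _ "derived G N"]
    by (rule generate_subgroup_incl[OF _ subgroup_pointwise_fixer[OF N(1) S(1)]])
qed

end

section \<open>A normal subgroup transitive on blocks of prime size\<close>

text \<open>
  A normal subgroup \<open>N\<close> of a finite group acting on \<open>E\<close>, with sets \<open>S \<in> Bs\<close> of prime size \<open>q\<close> on each
  of which \<open>N\<close> acts transitively, which are permuted transitively by the ambient group, and whose
  points are together fixed by the identity of \<open>N\<close> only.
\<close>

locale transitive_on_prime_blocks = finite_group_action G E \<phi>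
  for G (structure) and E and \<phi> +
  fixes N and Bs :: "'c set set" and q :: nat
  assumes normal: "N \<lhd> G"
    and prime_q: "Factorial_Ring.prime q"
    and finite_Bs: "finite Bs"
    and block_subset: "S \<in> Bs \<Longrightarrow> S \<subseteq> E"
    and block_finite: "S \<in> Bs \<Longrightarrow> finite S"
    and block_card: "S \<in> Bs \<Longrightarrow> card S = q"
    and block_preserved: "\<lbrakk>S \<in> Bs; n \<in> N\<rbrakk> \<Longrightarrow> \<phi> n \<in> S \<rightarrow> S"
    and block_transitive: "S \<in> Bs \<Longrightarrow> transitive_on N S"
    and blocks_conj: "\<lbrakk>S \<in> Bs; S' \<in> Bs\<rbrakk> \<Longrightarrow> \<exists>g\<in>carrier G. \<phi> g ` S = S'"
    and faithful_on_blocks: "\<lbrakk>n \<in> N; \<And>S x. \<lbrakk>S \<in> Bs; x \<in> S\<rbrakk> \<Longrightarrow> \<phi> n x = x\<rbrakk> \<Longrightarrow> n = \<one>"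
begin

lemma subgroup_N: "subgroup N G"
  using normal by (rule normal_imp_subgroup)

lemma N_conj: "\<lbrakk>g \<in> carrier G; n \<in> N\<rbrakk> \<Longrightarrow> g \<otimes> n \<otimes> inv g \<in> N"
  using normal_invE(2)[OF normal] .

lemma N_carrier: "n \<in> N \<Longrightarrow> n \<in> carrier G"
  using subgroup.mem_carrier[OF subgroup_N] .

text \<open>The fixers of two blocks are conjugate, hence of equal order.\<close>

lemma pointwise_fixer_eqI:
  assumes S: "S \<in> Bs" "S' \<in> Bs" and sub: "pointwise_fixer N S \<subseteq> pointwise_fixer N S'"
  shows "pointwise_fixer N S = pointwise_fixer N S'"
proof -
  have fin: "finite (pointwise_fixer N T)" for T
    by (rule finite_subset[OF _ finite_carrier]) (use N_carrier in \<open>auto simp: pointwise_fixer_def\<close>)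
  obtain g where g: "g \<in> carrier G" "\<phi> g ` S' = S" using blocks_conj S by blast
  define conj where "conj n = g \<otimes> n \<otimes> inv g" for n
  have "conj n \<in> pointwise_fixer N S" if "n \<in> pointwise_fixer N S'" for n
  proof -
    have "n \<in> N" using that unfolding pointwise_fixer_def by blast
    then show ?thesis
      using pointwise_fixer_conj[OF g(1) subgroup.subset[OF subgroup_N] block_subset[OF S(2)] that
          N_conj[OF g(1)]] g(2)
      unfolding conj_def by simp
  qed
  moreover have "inj_on conj (pointwise_fixer N S')"
    using g(1) N_carrier unfolding conj_def pointwise_fixer_def by (intro inj_onI) auto
  ultimately have "card (pointwise_fixer N S') \<le> card (pointwise_fixer N S)"
    using fin by (intro card_inj_on_le[of conj]) auto
  then show ?thesis by (rule card_seteq[OF fin sub])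
qed

lemma pointwise_fixer_Union_normalized:
  assumes F: "F \<subseteq> Bs" and n: "n \<in> N" "a \<in> pointwise_fixer N (\<Union>F)"
  shows "n \<otimes> a \<otimes> inv n \<in> pointwise_fixer N (\<Union>F)"
proof -
  have FE: "\<Union>F \<subseteq> E" using F block_subset by blast
  have "\<phi> m \<in> \<Union>F \<rightarrow> \<Union>F" if "m \<in> N" for m
    using block_preserved[OF _ that] F by blast
  then have "\<phi> n ` \<Union>F = \<Union>F"
    by (rule image_eq_of_subgroup[OF subgroup_N _ FE n(1)])
  moreover have "a \<in> N" using n(2) unfolding pointwise_fixer_def by blast
  ultimately show ?thesis
    using pointwise_fixer_conj[OF N_carrier[OF n(1)] subgroup.subset[OF subgroup_N] FE n(2)
        N_conj[OF N_carrier[OF n(1)]]] by simp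
qed

lemma exists_moved:
  assumes "S \<in> Bs"
  shows "\<exists>n\<in>N. \<exists>x\<in>S. \<phi> n x \<noteq> x"
  using exists_moved_of_transitive_on[OF block_transitive[OF assms] block_finite[OF assms]]
    block_card[OF assms] prime_gt_1_nat[OF prime_q] by simp

text \<open>
  Adding one block at a time: the commutators of the fixer of \<open>S'\<close> with the fixer of the blocks
  treated so far fix all these blocks, but they cannot all fix \<open>S\<close>.
\<close>

lemma pointwise_fixer_Union_moves:
  assumes perfect: "derived G N = N" and S: "S \<in> Bs"
    and F: "finite F" "F \<subseteq> Bs" "\<And>S'. S' \<in> F \<Longrightarrow> pointwise_fixer N S' \<noteq> pointwise_fixer N S"
  shows "\<exists>n\<in>pointwise_fixer N (\<Union>F). \<exists>x\<in>S. \<phi> n x \<noteq> x"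
  using F
proof (induction F rule: finite_induct)
  case empty
  then show ?case using exists_moved[OF S] by (simp add: pointwise_fixer_def)
next
  case (insert S' F)
  define A where "A = pointwise_fixer N S'"
  define B where "B = pointwise_fixer N (\<Union>F)"
  have S': "S' \<in> Bs" and F: "F \<subseteq> Bs" using insert.prems by auto
  have "A \<noteq> pointwise_fixer N S" using insert.prems(2) unfolding A_def by blast
  then have "\<not> A \<subseteq> pointwise_fixer N S" using pointwise_fixer_eqI[OF S' S] unfolding A_def by blast
  then obtain a0 x0 where a0: "a0 \<in> A" "x0 \<in> S" "\<phi> a0 x0 \<noteq> x0"
    unfolding A_def pointwise_fixer_def by blast
  obtain b0 y0 where b0: "b0 \<in> B" "y0 \<in> S" "\<phi> b0 y0 \<noteq> y0"
    using insert.IH[OF F] insert.prems(2) unfolding B_def by blast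
  have AN: "A \<subseteq> N" and BN: "B \<subseteq> N" unfolding A_def B_def pointwise_fixer_def by auto
  have A: "subgroup A G" and B: "subgroup B G"
    unfolding A_def B_def using F S' block_subset
    by (auto intro!: subgroup_pointwise_fixer[OF subgroup_N])
  have Aconj: "n \<otimes> a \<otimes> inv n \<in> A" if "n \<in> N" "a \<in> A" for n a
    using pointwise_fixer_Union_normalized[of "{S'}"] S' that unfolding A_def by simp
  have Bconj: "n \<otimes> b \<otimes> inv n \<in> B" if "n \<in> N" "b \<in> B" for n b
    using pointwise_fixer_Union_normalized[OF F] that unfolding B_def by simp
  show ?case
  proof (rule ccontr)
    assume none: "\<not> ?thesis"
    have comm: "\<phi> a (\<phi> b x) = \<phi> b (\<phi> a x)" if ab: "a \<in> A" "b \<in> B" and x: "x \<in> S" for a b x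
    proof -
      have c: "a \<in> carrier G" "b \<in> carrier G" and abN: "a \<in> N" "b \<in> N"
        using ab AN BN N_carrier by auto
      let ?t = "a \<otimes> b \<otimes> inv a \<otimes> inv b"
      have "b \<otimes> inv a \<otimes> inv b \<in> A" using Aconj[OF abN(2) subgroup.m_inv_closed[OF A ab(1)]] .
      then have tA: "?t \<in> A" using subgroup.m_closed[OF A ab(1)] c by (simp add: m_assoc)
      have "a \<otimes> b \<otimes> inv a \<in> B" using Bconj[OF abN(1) ab(2)] .
      then have tB: "?t \<in> B" using subgroup.m_closed[OF B _ subgroup.m_inv_closed[OF B ab(2)]] by simp
      have "?t \<in> pointwise_fixer N (\<Union>(insert S' F))"
        using tA tB unfolding A_def B_def pointwise_fixer_def by auto
      then have fix_t: "\<phi> ?t y = y" if "y \<in> S" for y using none that by blast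
      have "x \<in> E" using x block_subset[OF S] by blast
      then have "\<phi> a (\<phi> b x) = \<phi> ?t (\<phi> b (\<phi> a x))" using commutator_apply[OF c] by simp
      also have "\<dots> = \<phi> b (\<phi> a x)"
        using fix_t block_preserved[OF S] abN x by blast
      finally show ?thesis .
    qed
    have "derived G (derived G N) \<subseteq> pointwise_fixer N S"
      by (rule derived_derived_fixes[OF block_subset[OF S] block_finite[OF S] block_card[OF S] prime_q
            subgroup_N block_preserved[OF S] block_transitive[OF S] A AN Aconj B BN Bconj a0 b0 comm])
    then have "N \<subseteq> pointwise_fixer N S" using perfect by simp
    then show False using exists_moved[OF S] unfolding pointwise_fixer_def by blast
  qed
qed

text \<open>
  Among the elements \<open>x\<close> of \<open>N\<close> with \<open>x\<^sup>q = 1\<close>, one that moves the largest number of blocks moves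
  all of them: for a block \<open>S\<close> fixed pointwise by \<open>x\<close>, a suitable \<open>y\<close> moves exactly the blocks with the same
  fixer as \<open>S\<close>, all of which are fixed by \<open>x\<close>, and \<open>x y\<close> is a better choice.
\<close>

lemma exists_prime_order_element_moving_all_blocks:
  assumes perfect: "derived G N = N"
  shows "\<exists>x\<in>N. x [^] q = \<one> \<and> (\<forall>S\<in>Bs. \<exists>s\<in>S. \<phi> x s \<noteq> s)"
proof -
  define moved where "moved x = {S \<in> Bs. \<exists>s\<in>S. \<phi> x s \<noteq> s}" for x
  define P where "P x \<longleftrightarrow> x \<in> N \<and> x [^] q = \<one>" for x
  have "P \<one>" unfolding P_def using subgroup.one_closed[OF subgroup_N] by simp
  moreover have bound: "card (moved x) < Suc (card Bs)" for x
    using card_mono[OF finite_Bs, of "moved x"] unfolding moved_def by auto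
  ultimately have "\<exists>x. P x \<and> (\<forall>y. P y \<longrightarrow> card (moved y) \<le> card (moved x))"
    by (intro ex_has_greatest_nat[of P \<one> "\<lambda>x. card (moved x)" "Suc (card Bs)"]) auto
  then obtain x where x: "P x" and max: "\<And>y. P y \<Longrightarrow> card (moved y) \<le> card (moved x)"
    by blast
  have xN: "x \<in> N" and xq: "x [^] q = \<one>" using x unfolding P_def by auto
  have "S \<in> moved x" if S: "S \<in> Bs" for S
  proof (rule ccontr)
    assume "S \<notin> moved x"
    then have xS: "x \<in> pointwise_fixer N S" using S xN unfolding moved_def pointwise_fixer_def by blast
    define F where "F = {S' \<in> Bs. pointwise_fixer N S' \<noteq> pointwise_fixer N S}"
    define D where "D = pointwise_fixer N (\<Union>F)"
    have F: "finite F" "F \<subseteq> Bs" unfolding F_def using finite_Bs by auto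
    have DN: "D \<subseteq> N" unfolding D_def pointwise_fixer_def by auto
    have D: "subgroup D G"
      unfolding D_def using F(2) block_subset by (auto intro!: subgroup_pointwise_fixer[OF subgroup_N])
    have Dpres: "\<phi> d \<in> S \<rightarrow> S" if "d \<in> D" for d using block_preserved[OF S] that DN by blast
    have "\<exists>d\<in>D. \<exists>s\<in>S. \<phi> d s \<noteq> s"
      unfolding D_def by (rule pointwise_fixer_Union_moves[OF perfect S F]) (simp add: F_def)
    then obtain d s where d: "d \<in> D" "s \<in> S" "\<phi> d s \<noteq> s" by blast
    have "transitive_on D S"
    proof (rule transitive_on_of_normalized[OF block_subset[OF S] block_finite[OF S] block_card[OF S]
            prime_q D Dpres _ block_transitive[OF S] _ d])
      show "N \<subseteq> carrier G" using N_carrier by blast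
      show "m \<otimes> a \<otimes> inv m \<in> D" if "m \<in> N" "a \<in> D" for m a
        using pointwise_fixer_Union_normalized[OF F(2)] that unfolding D_def by blast
    qed
    then have "q dvd card D"
      using card_dvd_of_transitive[OF D Dpres _ block_subset[OF S] d(2)] block_card[OF S] by simp
    moreover have "finite D" using finite_subset[OF subgroup.subset[OF D] finite_carrier] .
    ultimately obtain y where y: "y \<in> D" "y \<noteq> \<one>" "y [^] q = \<one>"
      using exists_element_of_prime_order[OF D _ prime_q] by blast
    have yN: "y \<in> N" using y(1) DN by blast
    have y_F: "\<phi> y t = t" if "S' \<in> F" "t \<in> S'" for S' t
      using y(1) that unfolding D_def pointwise_fixer_def by blast
    have x_class: "\<phi> x t = t" if "S' \<in> Bs" "S' \<notin> F" "t \<in> S'" for S' t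
      using xS that unfolding F_def pointwise_fixer_def by blast
    have y_class: "\<exists>t\<in>S'. \<phi> y t \<noteq> t" if S': "S' \<in> Bs" "S' \<notin> F" for S'
    proof (rule ccontr)
      assume "\<not> ?thesis"
      then have yS': "y \<in> pointwise_fixer N S'" using yN unfolding pointwise_fixer_def by blast
      have "y = \<one>"
      proof (rule faithful_on_blocks[OF yN])
        fix T t assume T: "T \<in> Bs" "t \<in> T"
        show "\<phi> y t = t"
        proof (cases "T \<in> F")
          case True
          then show ?thesis using y_F T(2) by blast
        next
          case False
          then have "y \<in> pointwise_fixer N T" using yS' T(1) S' unfolding F_def by auto
          then show ?thesis using T(2) unfolding pointwise_fixer_def by blast
        qed
      qed
      then show False using y(2) by blast
    qed
    define z where "z = x \<otimes> y"
    have zN: "z \<in> N" unfolding z_def using subgroup.m_closed[OF subgroup_N xN yN] .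
    have z_F: "\<phi> z t = \<phi> x t" if "S' \<in> F" "t \<in> S'" for S' t
    proof -
      have "t \<in> E" using that F(2) block_subset by blast
      then show ?thesis
        using y_F[OF that] N_carrier xN yN unfolding z_def by (simp add: composition_rule)
    qed
    have z_class: "\<phi> z t = \<phi> y t" if "S' \<in> Bs" "S' \<notin> F" "t \<in> S'" for S' t
    proof -
      have "\<phi> y t \<in> S'" using block_preserved[OF that(1) yN] that(3) by blast
      moreover have "t \<in> E" using that block_subset by blast
      ultimately show ?thesis
        using x_class[OF that(1,2)] N_carrier xN yN unfolding z_def by (simp add: composition_rule)
    qed
    have "z [^] q = \<one>"
    proof (rule faithful_on_blocks[OF subgroup_nat_pow_closed[OF subgroup_N zN]])
      fix T t assume T: "T \<in> Bs" "t \<in> T"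
      have tE: "t \<in> E" using T block_subset by blast
      have "\<exists>w\<in>N. w [^] q = \<one> \<and> (\<forall>u\<in>T. \<phi> z u = \<phi> w u)"
      proof (cases "T \<in> F")
        case True
        then show ?thesis using z_F xN xq by blast
      next
        case False
        then show ?thesis using z_class T(1) yN y(3) by blast
      qed
      then obtain w where w: "w \<in> N" "w [^] q = \<one>" "\<And>u. u \<in> T \<Longrightarrow> \<phi> z u = \<phi> w u" by blast
      have "\<phi> (z [^] q) t = (\<phi> z ^^ q) t" using pow_apply[OF N_carrier[OF zN] tE] .
      also have "\<dots> = (\<phi> w ^^ q) t"
        by (rule funpow_agree[OF w(3) block_preserved[OF T(1) w(1)] T(2)])
      also have "\<dots> = t"
        using pow_apply[OF N_carrier[OF w(1)] tE, of q] w(2) one_apply[OF tE] by simp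
      finally show "\<phi> (z [^] q) t = t" .
    qed
    then have "P z" using zN unfolding P_def by blast
    moreover have "moved x \<subset> moved z"
    proof
      show "moved x \<subseteq> moved z"
      proof
        fix T assume "T \<in> moved x"
        then obtain t where T: "T \<in> Bs" "t \<in> T" "\<phi> x t \<noteq> t" unfolding moved_def by blast
        then have "T \<in> F" using x_class by blast
        then have "\<phi> z t \<noteq> t" using z_F T by simp
        then show "T \<in> moved z" using T unfolding moved_def by blast
      qed
      have "S \<notin> F" unfolding F_def by blast
      then have "S \<in> moved z" using y_class[OF S] z_class[OF S] S unfolding moved_def by auto
      then show "moved x \<noteq> moved z" using \<open>S \<notin> moved x\<close> by blast
    qed
    moreover have "finite (moved z)" using finite_Bs unfolding moved_def by simp
    ultimately show False using max[of z] psubset_card_mono[of "moved z" "moved x"] by simp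
  qed
  then show ?thesis using xN xq unfolding moved_def by blast
qed

text \<open>
  An element \<open>h\<close> that preserves a block acts on it as an affine map of \<open>\<int>/q\<close>, since it normalizes
  the action of the abelian group \<open>N\<close>, which is cyclic of order \<open>q\<close> there. Without fixed points it
  is a translation.
\<close>

lemma derangement_pow_prime_fixes:
  assumes abelian: "\<And>m n. \<lbrakk>m \<in> N; n \<in> N\<rbrakk> \<Longrightarrow> m \<otimes> n = n \<otimes> m"
    and S: "S \<in> Bs" and h: "h \<in> carrier G" "\<phi> h \<in> S \<rightarrow> S" "\<And>x. x \<in> S \<Longrightarrow> \<phi> h x \<noteq> x"
    and x: "x \<in> S"
  shows "\<phi> (h [^] q) x = x"
proof -
  have SE: "x \<in> E" if "x \<in> S" for x using that block_subset[OF S] by blast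
  obtain c z where c: "c \<in> N" "z \<in> S" "\<phi> c z \<noteq> z" using exists_moved[OF S] by blast
  have semireg: "semiregular_on N S"
    unfolding semiregular_on_def
  proof (intro ballI impI)
    fix a x y assume a: "a \<in> N" "x \<in> S" "y \<in> S" "\<phi> a x = x"
    obtain b where b: "b \<in> N" "\<phi> b x = y" using transitive_onE[OF block_transitive[OF S] a(2,3)] .
    have "\<phi> a y = \<phi> (a \<otimes> b) x"
      using a(1) b N_carrier SE[OF a(2)] by (simp add: composition_rule)
    also have "a \<otimes> b = b \<otimes> a" using abelian a(1) b(1) .
    also have "\<phi> (b \<otimes> a) x = y"
      using a b N_carrier SE[OF a(2)] by (simp add: composition_rule)
    finally show "\<phi> a y = y" .
  qed
  have pres: "\<forall>n\<in>N. \<phi> n \<in> S \<rightarrow> S" using block_preserved[OF S] by blast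
  note cyc = semiregular_prime_cyclic[OF block_subset[OF S] block_finite[OF S] block_card[OF S] prime_q
      subgroup_N pres semireg c]
  obtain k where k: "\<forall>x\<in>S. \<phi> (h \<otimes> c \<otimes> inv h) x = (\<phi> c ^^ k) x"
    using cyc(2) N_conj[OF h(1) c(1)] by blast
  have "(\<phi> h ^^ q) x = x"
  proof (rule fixed_point_free_affine_period[OF prime_q block_finite[OF S] block_card[OF S]
        block_preserved[OF S c(1)] _ c(2,3) h(2) _ h(3) x])
    show "(\<phi> c ^^ q) y = y" if "y \<in> S" for y using cyc(1) that by blast
    show "\<phi> h (\<phi> c y) = (\<phi> c ^^ k) (\<phi> h y)" if "y \<in> S" for y
    proof -
      have "\<phi> h y \<in> S" using h(2) that by blast
      then show ?thesis
        using k conj_apply[OF h(1) N_carrier[OF c(1)] SE[OF that]] by simp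
    qed
  qed
  then show ?thesis using pow_apply[OF h(1) SE[OF x]] by simp
qed

end

section \<open>Intersection density\<close>

lemma finite_perm_group_action:
  assumes fin: "finite \<Omega>" and tr: "transitive_perm_group \<Omega> G"
  shows "finite_group_action (perm_group \<Omega> G) \<Omega> (\<lambda>g. g)"
proof -
  interpret transitive_action "perm_group \<Omega> G" \<Omega> "\<lambda>g. g"
    using tr by (simp add: transitive_perm_group_def)
  have sub: "subgroup G (BijGroup \<Omega>)" using tr by (simp add: transitive_perm_group_def)
  interpret group "perm_group \<Omega> G"
    using subgroup.subgroup_is_group[OF sub group_BijGroup] .
  have "G \<subseteq> \<Omega> \<rightarrow>\<^sub>E \<Omega>"
    using subgroup.subset[OF sub]
    by (auto simp: BijGroup_def Bij_def bij_betw_def extensional_def PiE_def subset_iff)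
  then have "finite G" using fin by (meson finite_PiE finite_subset)
  then show ?thesis by unfold_locales simp
qed

lemma perm_group_eqI:
  assumes "subgroup G (BijGroup \<Omega>)" "g \<in> G" "h \<in> G" "\<And>x. x \<in> \<Omega> \<Longrightarrow> g x = h x"
  shows "g = h"
proof -
  have "g \<in> extensional \<Omega>" "h \<in> extensional \<Omega>"
    using subgroup.subset[OF assms(1)] assms(2,3) by (auto simp: BijGroup_def Bij_def)
  then show ?thesis using assms(4) extensionalityI by blast
qed

text \<open>
  The clique-coclique bound: for an intersecting \<open>F\<close> and a set \<open>C\<close> whose members pairwise disagree
  everywhere, the products \<open>f c\<^sup>-\<^sup>1\<close> are pairwise distinct, so \<open>|F| |C| \<le> |G|\<close>.
\<close>

lemma intersection_density_eq_1_of_sharply_transitive: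
  assumes fin: "finite \<Omega>" and tr: "transitive_perm_group \<Omega> G" and ne: "\<Omega> \<noteq> {}"
    and C: "C \<subseteq> G" "card C = card \<Omega>"
    and sharp: "\<And>c d \<omega>. \<lbrakk>c \<in> C; d \<in> C; \<omega> \<in> \<Omega>; c \<omega> = d \<omega>\<rbrakk> \<Longrightarrow> c = d"
  shows "intersection_density \<Omega> G = 1"
proof -
  interpret finite_group_action "perm_group \<Omega> G" \<Omega> "\<lambda>g. g"
    by (rule finite_perm_group_action[OF fin tr])
  interpret transitive_action "perm_group \<Omega> G" \<Omega> "\<lambda>g. g"
    using tr by (simp add: transitive_perm_group_def)
  let ?G = "perm_group \<Omega> G"
  obtain \<omega> where \<omega>: "\<omega> \<in> \<Omega>" using ne by blast
  define St where "St = stabilizer ?G (\<lambda>g. g) \<omega>"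
  have finG: "finite G" using finite_carrier by simp
  have StG: "St \<subseteq> G" unfolding St_def stabilizer_def by auto
  have "orbit ?G (\<lambda>g. g) \<omega> = \<Omega>"
    using unique_orbit[OF \<omega>] action_closed \<omega> unfolding orbit_def by auto
  then have orb: "card \<Omega> * card St = card G"
    using orbit_stabilizer_theorem[OF \<omega>] by (simp add: St_def order_def)
  have pos: "card \<Omega> > 0" using fin ne by (simp add: card_gt_0_iff)
  have Stpos: "card St > 0"
    using subgroup.one_closed[OF stabilizer_subgroup[OF \<omega>]] finite_subset[OF StG finG]
    unfolding St_def by (auto simp: card_gt_0_iff)
  have le: "card F \<le> card St" if F: "F \<subseteq> G" "intersecting \<Omega> F" for F
  proof -
    define pr where "pr = (\<lambda>(f, c). f \<otimes>\<^bsub>?G\<^esub> inv\<^bsub>?G\<^esub> c)"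
    have "inj_on pr (F \<times> C)"
    proof (rule inj_onI, clarify)
      fix f c f' c' assume m: "f \<in> F" "c \<in> C" "f' \<in> F" "c' \<in> C" and eq: "pr (f, c) = pr (f', c')"
      have cG: "f \<in> carrier ?G" "c \<in> carrier ?G" "f' \<in> carrier ?G" "c' \<in> carrier ?G"
        using m F(1) C(1) by auto
      obtain w where w: "w \<in> \<Omega>" "f w = f' w" using F(2) m unfolding intersecting_def by blast
      \<comment> \<open>The point \<open>c w\<close> is sent to \<open>f w = f' w\<close> by the common product, so \<open>c w = c' w\<close>.\<close>
      have "f' ((inv\<^bsub>?G\<^esub> c') (c w)) = f' w"
      proof -
        have "(f' \<otimes>\<^bsub>?G\<^esub> inv\<^bsub>?G\<^esub> c') (c w) = (f \<otimes>\<^bsub>?G\<^esub> inv\<^bsub>?G\<^esub> c) (c w)"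
          using eq unfolding pr_def by simp
        then show ?thesis
          using composition_rule[OF action_closed[OF cG(2) w(1)] cG(3) inv_closed[OF cG(4)]]
            composition_rule[OF action_closed[OF cG(2) w(1)] cG(1) inv_closed[OF cG(2)]]
            inv_apply[OF cG(2) w(1)] w(2) by simp
      qed
      moreover have "(inv\<^bsub>?G\<^esub> c') (c w) \<in> \<Omega>"
        using action_closed[OF inv_closed[OF cG(4)] action_closed[OF cG(2) w(1)]] .
      ultimately have "(inv\<^bsub>?G\<^esub> c') (c w) = w"
        using inj_onD[OF inj_prop[OF cG(3)]] w(1) by blast
      then have "c w = c' w"
        using apply_inv[OF cG(4) action_closed[OF cG(2) w(1)]] by simp
      then have "c = c'" using sharp m w(1) by blast
      then show "f = f' \<and> c = c'" using eq right_cancel[OF inv_closed[OF cG(4)] cG(1,3)]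
        unfolding pr_def by simp
    qed
    moreover have "pr ` (F \<times> C) \<subseteq> carrier ?G"
      using F(1) C(1) inv_closed m_closed unfolding pr_def by fastforce
    ultimately have "card (F \<times> C) \<le> card (carrier ?G)"
      using finite_carrier by (rule card_inj_on_le)
    then have "card \<Omega> * card F \<le> card \<Omega> * card St"
      using orb C(2) by (simp add: card_cartesian_product mult.commute)
    then show ?thesis using pos by simp
  qed
  have "intersecting \<Omega> St"
    using \<omega> unfolding intersecting_def St_def stabilizer_def
    by (auto intro!: bexI[of _ \<omega>])
  then have one: "1 \<in> {real (card F) / real (card St) | F. F \<subseteq> G \<and> intersecting \<Omega> F}"
    using StG Stpos by (intro CollectI exI[of _ St]) auto
  have "finite {real (card F) / real (card St) | F. F \<subseteq> G \<and> intersecting \<Omega> F}"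
    by (rule finite_subset[of _ "(\<lambda>F. real (card F) / real (card St)) ` Pow G"]) (use finG in auto)
  then have "Max {real (card F) / real (card St) | F. F \<subseteq> G \<and> intersecting \<Omega> F} = 1"
    using le Stpos one by (intro Max_eqI) auto
  then show ?thesis
    using intersection_density_eq[OF fin tr \<omega>] unfolding St_def by simp
qed

text \<open>
  An element \<open>x\<close> of order \<open>q\<close> that preserves all blocks and moves each of them is semiregular, and an
  element \<open>g\<close> of order \<open>p\<close> permutes the \<open>p\<close> blocks cyclically because \<open>p > q\<close>. The products
  \<open>g\<^sup>j x\<^sup>i\<close> form a sharply transitive set.
\<close>

lemma intersection_density_eq_1_of_semiregular:
  assumes p: "Factorial_Ring.prime (p::nat)" and q: "Factorial_Ring.prime (q::nat)" and pq: "p > q"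
    and fin: "finite \<Omega>" and card: "card \<Omega> = p * q"
    and tr: "transitive_perm_group \<Omega> G"
    and bs: "block_system \<Omega> G \<B>" and size: "\<And>S. S \<in> \<B> \<Longrightarrow> card S = q"
    and x: "x \<in> G" "\<And>S. S \<in> \<B> \<Longrightarrow> x ` S = S" "\<And>\<omega>. \<omega> \<in> \<Omega> \<Longrightarrow> (x ^^ q) \<omega> = \<omega>"
      "\<And>S. S \<in> \<B> \<Longrightarrow> \<exists>s\<in>S. x s \<noteq> s"
  shows "intersection_density \<Omega> G = 1"
proof -
  interpret finite_group_action "perm_group \<Omega> G" \<Omega> "\<lambda>g. g"
    by (rule finite_perm_group_action[OF fin tr])
  interpret transitive_action "perm_group \<Omega> G" \<Omega> "\<lambda>g. g"
    using tr by (simp add: transitive_perm_group_def)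
  let ?G = "perm_group \<Omega> G"
  have sub: "subgroup G (BijGroup \<Omega>)" using tr by (simp add: transitive_perm_group_def)
  have part: "partition_on \<Omega> \<B>" using bs unfolding block_system_def by blast
  obtain S0 where S0: "\<B> = {g ` S0 | g. g \<in> G}" "S0 \<subseteq> \<Omega>"
    using bs unfolding block_system_def is_block_def by blast
  have BO: "S \<subseteq> \<Omega>" if "S \<in> \<B>" for S using partition_onD1[OF part] that by blast
  have disj: "S = T" if "S \<in> \<B>" "T \<in> \<B>" "\<omega> \<in> S" "\<omega> \<in> T" for S T \<omega>
    using partition_onD2[OF part] that unfolding disjoint_def by blast
  have finB: "finite \<B>" using finite_elements[OF fin part] .
  have cardB: "card \<B> = p"
  proof -
    have "q * card \<B> = card (\<Union>\<B>)"
      by (rule card_partition)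
        (use finB size disj fin partition_onD1[OF part] in \<open>auto simp: disjoint_iff\<close>)
    then show ?thesis using card partition_onD1[OF part] prime_gt_0_nat[OF q] by simp
  qed
  have ne: "\<Omega> \<noteq> {}" using card prime_gt_0_nat[OF p] prime_gt_0_nat[OF q] by auto
  obtain \<omega>0 where \<omega>0: "\<omega>0 \<in> \<Omega>" using ne by blast
  have "transitive_on (carrier ?G) \<Omega>" unfolding transitive_on_def using unique_orbit by blast
  then have "card \<Omega> dvd card (carrier ?G)"
    using card_dvd_of_transitive[OF subgroup_self _ _ subset_refl \<omega>0] action_closed by blast
  then have "p dvd card (carrier ?G)" using card by (metis dvd_mult_left)
  then obtain g where g: "g \<in> G" "g \<noteq> \<one>\<^bsub>?G\<^esub>" "g [^]\<^bsub>?G\<^esub> p = \<one>\<^bsub>?G\<^esub>"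
    using exists_element_of_prime_order[OF subgroup_self finite_carrier p] by auto
  have gp: "(g ^^ p) \<omega> = \<omega>" if "\<omega> \<in> \<Omega>" for \<omega>
    using pow_apply[of g \<omega> p] g that one_apply by simp
  have g_maps: "g \<in> \<Omega> \<rightarrow> \<Omega>" using action_closed[of g] g(1) by auto
  have g_inj: "\<omega> = \<omega>'" if "(g ^^ j) \<omega> = (g ^^ j) \<omega>'" "\<omega> \<in> \<Omega>" "\<omega>' \<in> \<Omega>" for j \<omega> \<omega>'
    using that inj_onD[OF inj_prop[of "g [^]\<^bsub>?G\<^esub> j"], of \<omega> \<omega>'] nat_pow_closed[of g j] g(1)
    by (simp add: pow_apply)
  define f where "f = (\<lambda>S. g ` S)"
  have f_pow: "(f ^^ j) S = (g ^^ j) ` S" for j S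
    by (induction j) (auto simp: f_def image_image)
  have f_maps: "f \<in> \<B> \<rightarrow> \<B>"
  proof
    fix S assume "S \<in> \<B>"
    then obtain h where h: "h \<in> G" "S = h ` S0" using S0(1) by blast
    have "f S = (g \<otimes>\<^bsub>?G\<^esub> h) ` S0"
      unfolding f_def h(2) image_image using S0(2) composition_rule[of _ g h] g(1) h(1)
      by (intro image_cong) auto
    moreover have "g \<otimes>\<^bsub>?G\<^esub> h \<in> G" using m_closed[of g h] g(1) h(1) by simp
    ultimately show "f S \<in> \<B>" unfolding S0(1) by blast
  qed
  have f_per: "(f ^^ p) S = S" if "S \<in> \<B>" for S
    unfolding f_pow using gp BO[OF that] by force
  have "\<exists>S\<in>\<B>. f S \<noteq> S"
  proof (rule ccontr)
    assume none: "\<not> ?thesis"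
    have "\<exists>w\<in>\<Omega>. g w \<noteq> w"
    proof (rule ccontr)
      assume "\<not> ?thesis"
      then have "g = \<one>\<^bsub>?G\<^esub>"
        using perm_group_eqI[OF sub g(1), of "\<one>\<^bsub>?G\<^esub>"] one_closed one_apply by simp
      then show False using g(2) by blast
    qed
    then obtain w where w: "w \<in> \<Omega>" "g w \<noteq> w" by blast
    then obtain S where S: "S \<in> \<B>" "w \<in> S" using partition_onD1[OF part] by blast
    \<comment> \<open>All blocks being preserved, the orbit of \<open>w\<close> of size \<open>p\<close> lies in a block of size \<open>q < p\<close>.\<close>
    have "g \<in> S \<rightarrow> S" using none S(1) unfolding f_def by blast
    then have "p \<le> card S"
      using prime_period_le_card[OF p gp[OF w(1)] w(2) finite_subset[OF BO[OF S(1)] fin] _ S(2)]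
      by blast
    then show False using size[OF S(1)] pq by simp
  qed
  then obtain S1 where S1: "S1 \<in> \<B>" "f S1 \<noteq> S1" by blast
  have f_inj: "inj_on (\<lambda>j. (f ^^ j) S) {..<p}" if "S \<in> \<B>" for S
    by (rule prime_cycle_inj_on[OF p f_per finB cardB f_maps S1 that])
  define c where "c = (\<lambda>(j, i). g [^]\<^bsub>?G\<^esub> (j::nat) \<otimes>\<^bsub>?G\<^esub> x [^]\<^bsub>?G\<^esub> (i::nat))"
  have c_apply: "c (j, i) \<omega> = (g ^^ j) ((x ^^ i) \<omega>)" if "\<omega> \<in> \<Omega>" for j i \<omega>
    using composition_rule[OF that, of "g [^]\<^bsub>?G\<^esub> j" "x [^]\<^bsub>?G\<^esub> i"] nat_pow_closed[of g j]
      nat_pow_closed[of x i] g(1) x(1) pow_apply[of x \<omega> i] action_closed[of "x [^]\<^bsub>?G\<^esub> i" \<omega>]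
      pow_apply[of g "(x ^^ i) \<omega>" j] that
    unfolding c_def by simp
  have key: "j = j' \<and> i = i'"
    if b: "j < p" "j' < p" "i < q" "i' < q" and \<omega>: "\<omega> \<in> \<Omega>" and eq: "c (j, i) \<omega> = c (j', i') \<omega>"
    for j j' i i' \<omega>
  proof -
    obtain S where S: "S \<in> \<B>" "\<omega> \<in> S" using \<omega> partition_onD1[OF part] by blast
    have xS: "x \<in> S \<rightarrow> S" using x(2)[OF S(1)] by blast
    have xi: "(x ^^ k) \<omega> \<in> S" for k using funpow_mem[OF xS S(2)] .
    have "c (j, i) \<omega> \<in> (f ^^ j) S" "c (j, i) \<omega> \<in> (f ^^ j') S"
      using imageI[OF xi[of i], of "g ^^ j"] imageI[OF xi[of i'], of "g ^^ j'"] eq c_apply[OF \<omega>]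
      unfolding f_pow by auto
    then have "(f ^^ j) S = (f ^^ j') S"
      using disj funpow_mem[OF f_maps S(1)] by blast
    then have j: "j = j'" using inj_onD[OF f_inj[OF S(1)]] b by simp
    then have "(x ^^ i) \<omega> = (x ^^ i') \<omega>"
      using eq c_apply[OF \<omega>] g_inj xi BO[OF S(1)] by (metis subsetD)
    moreover obtain s where s: "s \<in> S" "x s \<noteq> s" using x(4)[OF S(1)] by blast
    have "inj_on (\<lambda>i. (x ^^ i) \<omega>) {..<q}"
    proof (rule prime_cycle_inj_on[OF q _ finite_subset[OF BO[OF S(1)] fin] size[OF S(1)] xS s S(2)])
      show "(x ^^ q) y = y" if "y \<in> S" for y using x(3) BO[OF S(1)] that by blast
    qed
    ultimately show ?thesis using j inj_onD b by fastforce
  qed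
  define C where "C = c ` ({..<p} \<times> {..<q})"
  have CG: "C \<subseteq> G"
  proof
    fix d assume "d \<in> C"
    then obtain j i where d: "d = c (j, i)" unfolding C_def by auto
    have "c (j, i) \<in> carrier ?G"
      unfolding c_def using g(1) x(1) nat_pow_closed m_closed by simp
    then show "d \<in> G" using d by simp
  qed
  have "inj_on c ({..<p} \<times> {..<q})"
  proof (rule inj_onI, clarify)
    fix j i j' i' assume "j < p" "i < q" "j' < p" "i' < q" "c (j, i) = c (j', i')"
    then show "j = j' \<and> i = i'" using key[of j j' i i' \<omega>0] \<omega>0 by simp
  qed
  then have cardC: "card C = card \<Omega>"
    unfolding C_def card by (simp add: card_image card_cartesian_product)
  show ?thesis
  proof (rule intersection_density_eq_1_of_sharply_transitive[OF fin tr ne CG cardC])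
    fix d e w assume "d \<in> C" "e \<in> C" "w \<in> \<Omega>" "d w = e w"
    then show "d = e" using key unfolding C_def by fastforce
  qed
qed

section \<open>Groups of degree a product of two primes\<close>

lemma block_kernel_eq:
  "block_kernel \<Omega> \<B> G = {g \<in> G. \<forall>S\<in>\<B>. g ` S = S}"
proof -
  have "(\<lambda>S\<in>\<B>. g ` S) = (\<lambda>S\<in>\<B>. S) \<longleftrightarrow> (\<forall>S\<in>\<B>. g ` S = S)" for g :: "'a \<Rightarrow> 'a"
    by (metis restrict_apply' restrict_ext)
  then show ?thesis
    unfolding block_kernel_def kernel_def induced_perm_def by (simp add: BijGroup_def)
qed

lemma (in group) comm_group_of_derived_trivial:
  assumes "subgroup N G" "derived G N = {\<one>}"
  shows "comm_group (G\<lparr>carrier := N\<rparr>)"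
proof -
  interpret N: group "G\<lparr>carrier := N\<rparr>" using subgroup.subgroup_is_group[OF assms(1) is_group] .
  show ?thesis
  proof (rule N.group_comm_groupI)
    fix m n assume "m \<in> carrier (G\<lparr>carrier := N\<rparr>)" "n \<in> carrier (G\<lparr>carrier := N\<rparr>)"
    then have mn: "m \<in> N" "n \<in> N" by auto
    then have c: "m \<in> carrier G" "n \<in> carrier G" using subgroup.mem_carrier[OF assms(1)] by auto
    have "m \<otimes> n \<otimes> inv m \<otimes> inv n \<in> derived G N"
      unfolding derived_def using mn by (intro generate.incl) blast
    then have "m \<otimes> n \<otimes> inv m \<otimes> inv n = \<one>" using assms(2) by blast
    then have "m \<otimes> n \<otimes> inv m = n" using c inv_equality[of "m \<otimes> n \<otimes> inv m" "inv n"] by simp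
    then have "m \<otimes> n \<otimes> inv m \<otimes> m = n \<otimes> m" by simp
    then have "m \<otimes> n = n \<otimes> m" using c by (simp add: m_assoc)
    then show "m \<otimes>\<^bsub>G\<lparr>carrier := N\<rparr>\<^esub> n = n \<otimes>\<^bsub>G\<lparr>carrier := N\<rparr>\<^esub> m" by simp
  qed
qed

theorem theorem1p4:
  fixes p q :: nat
    and \<Omega> :: "'a set"
    and G H N :: "('a \<Rightarrow> 'a) set"
    and \<B> :: "'a set set"
  assumes "Factorial_Ring.prime p" "Factorial_Ring.prime q" "odd p" "odd q" "p > q"
    and "finite \<Omega>" "card \<Omega> = p * q"
    and "transitive_perm_group \<Omega> G"
    and "nontrivial_block_system \<Omega> G \<B>"
    and "\<forall>\<C>. nontrivial_block_system \<Omega> G \<C> \<longrightarrow> \<C> = \<B>"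
    and "\<forall>S\<in>\<B>. card S = q"
    and "H = block_kernel \<Omega> \<B> G"
    and "H \<noteq> {\<one>\<^bsub>perm_group \<Omega> G\<^esub>}"
    and "minimal_normal_subgroup N (perm_group \<Omega> G)"
    and "N \<subseteq> H"
  shows "(\<not> comm_group (perm_group \<Omega> N) \<longrightarrow> intersection_density \<Omega> G = 1)
       \<and> (comm_group (perm_group \<Omega> N) \<and> (\<exists>h\<in>H. derangement \<Omega> h) \<longrightarrow> intersection_density \<Omega> G = 1)"
proof -
  let ?G = "perm_group \<Omega> G"
  note p = assms(1) and q = assms(2) and fin = assms(6) and tr = assms(8)
  interpret finite_group_action ?G \<Omega> "\<lambda>g. g"
    by (rule finite_perm_group_action[OF fin tr])
  interpret transitive_action ?G \<Omega> "\<lambda>g. g"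
    using tr by (simp add: transitive_perm_group_def)
  have sub: "subgroup G (BijGroup \<Omega>)" using tr by (simp add: transitive_perm_group_def)
  have bs: "block_system \<Omega> G \<B>" using assms(9) unfolding nontrivial_block_system_def by blast
  have part: "partition_on \<Omega> \<B>" using bs unfolding block_system_def by blast
  have BO: "S \<subseteq> \<Omega>" if "S \<in> \<B>" for S using partition_onD1[OF part] that by blast
  have H: "H = {g \<in> G. \<forall>S\<in>\<B>. g ` S = S}" unfolding assms(12) by (rule block_kernel_eq)
  have Nn: "N \<lhd> ?G" "N \<noteq> {\<one>\<^bsub>?G\<^esub>}"
    and Nmin: "\<And>K. K \<lhd> ?G \<Longrightarrow> K \<subseteq> N \<Longrightarrow> K = {\<one>\<^bsub>?G\<^esub>} \<or> K = N"
    using assms(14) unfolding minimal_normal_subgroup_def by blast+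
  have Nsub: "subgroup N ?G" using normal_imp_subgroup[OF Nn(1)] .
  have NG: "n \<in> G" if "n \<in> N" for n using subgroup.mem_carrier[OF Nsub that] by simp
  have Npres: "n \<in> S \<rightarrow> S" if "S \<in> \<B>" "n \<in> N" for S n
    using assms(15) that unfolding H by blast
  have eq_one: "g = \<one>\<^bsub>?G\<^esub>" if "g \<in> G" "\<And>w. w \<in> \<Omega> \<Longrightarrow> g w = w" for g
    using perm_group_eqI[OF sub that(1), of "\<one>\<^bsub>?G\<^esub>"] one_closed one_apply that(2) by simp
  have "\<exists>n0\<in>N. \<exists>w0\<in>\<Omega>. n0 w0 \<noteq> w0"
  proof (rule ccontr)
    assume "\<not> ?thesis"
    then have "N \<subseteq> {\<one>\<^bsub>?G\<^esub>}" using eq_one NG by blast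
    then show False using Nn(2) subgroup.one_closed[OF Nsub] by blast
  qed
  then obtain n0 w0 where n0: "n0 \<in> N" "w0 \<in> \<Omega>" "n0 w0 \<noteq> w0" by blast
  \<comment> \<open>\<open>N\<close> moves some point, hence by conjugation a point of every block.\<close>
  have B_tr: "transitive_on N S" if S: "S \<in> \<B>" for S
  proof -
    have "card S > 0" using assms(11) S prime_gt_0_nat[OF q] by simp
    then obtain y where y: "y \<in> S" by fastforce
    obtain g where g: "g \<in> carrier ?G" "g w0 = y"
      using unique_orbit[OF n0(2)] y BO[OF S] by blast
    define n where "n = g \<otimes>\<^bsub>?G\<^esub> n0 \<otimes>\<^bsub>?G\<^esub> inv\<^bsub>?G\<^esub> g"
    have n: "n \<in> N" unfolding n_def using normal_invE(2)[OF Nn(1) g(1) n0(1)] .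
    have n0c: "n0 \<in> carrier ?G" using NG[OF n0(1)] by simp
    have "n y = g (n0 w0)" unfolding n_def g(2)[symmetric] by (rule conj_apply[OF g(1) n0c n0(2)])
    then have ny: "n y \<noteq> y"
      using inj_onD[OF inj_prop[OF g(1)]] n0(2,3) action_closed[OF n0c n0(2)] g(2) by metis
    show ?thesis
    proof (rule transitive_on_of_normalized[OF BO[OF S] finite_subset[OF BO[OF S] fin] _ q Nsub
          Npres[OF S] subset_refl _ _ n y ny])
      show "card S = q" using assms(11) S by blast
      show "transitive_on (carrier ?G) S"
        unfolding transitive_on_def using unique_orbit BO[OF S] by blast
      show "m \<otimes>\<^bsub>?G\<^esub> a \<otimes>\<^bsub>?G\<^esub> inv\<^bsub>?G\<^esub> m \<in> N" if "m \<in> carrier ?G" "a \<in> N" for m a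
        using normal_invE(2)[OF Nn(1) that] .
    qed
  qed
  interpret transitive_on_prime_blocks ?G \<Omega> "\<lambda>g. g" N \<B> q
  proof (intro transitive_on_prime_blocks.intro transitive_on_prime_blocks_axioms.intro)
    show "finite_group_action ?G \<Omega> (\<lambda>g. g)" by (rule finite_perm_group_action[OF fin tr])
    show "N \<lhd> ?G" using Nn(1) .
    show "Factorial_Ring.prime q" using q .
    show "n \<in> S \<rightarrow> S" if "S \<in> \<B>" "n \<in> N" for S n using Npres that .
    show "transitive_on N S" if "S \<in> \<B>" for S using B_tr that .
    show "finite \<B>" using finite_elements[OF fin part] .
    show "S \<subseteq> \<Omega>" "finite S" "card S = q" if "S \<in> \<B>" for S
      using that BO finite_subset[OF BO fin] assms(11) by auto
    show "\<exists>g\<in>carrier ?G. g ` S = T" if ST: "S \<in> \<B>" "T \<in> \<B>" for S T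
    proof -
      obtain S0 where S0: "\<B> = {g ` S0 | g. g \<in> G}" "S0 \<subseteq> \<Omega>"
        using bs unfolding block_system_def is_block_def by blast
      obtain g h where gh: "g \<in> G" "S = g ` S0" "h \<in> G" "T = h ` S0" using ST S0(1) by blast
      have gc: "g \<in> carrier ?G" "h \<in> carrier ?G" using gh by auto
      have "(h \<otimes>\<^bsub>?G\<^esub> inv\<^bsub>?G\<^esub> g) (g s) = h s" if "s \<in> \<Omega>" for s
        using composition_rule[OF action_closed[OF gc(1) that] gc(2) inv_closed[OF gc(1)]]
          inv_apply[OF gc(1) that] by simp
      then have "(h \<otimes>\<^bsub>?G\<^esub> inv\<^bsub>?G\<^esub> g) ` S = T"
        unfolding gh image_image using S0(2) by (intro image_cong) auto
      then show ?thesis using m_closed[OF gc(2) inv_closed[OF gc(1)]] by blast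
    qed
    show "n = \<one>\<^bsub>?G\<^esub>" if "n \<in> N" "\<And>S x. \<lbrakk>S \<in> \<B>; x \<in> S\<rbrakk> \<Longrightarrow> n x = x" for n
      by (rule eq_one[OF NG[OF that(1)]]) (use that(2) partition_onD1[OF part] in blast)
  qed
  have density: "intersection_density \<Omega> G = 1"
    if x: "x \<in> H" "x [^]\<^bsub>?G\<^esub> q = \<one>\<^bsub>?G\<^esub>" "\<And>S. S \<in> \<B> \<Longrightarrow> \<exists>s\<in>S. x s \<noteq> s" for x
  proof (rule intersection_density_eq_1_of_semiregular[OF p q assms(5) fin assms(7) tr bs _ _ _ _ x(3)])
    show "(x ^^ q) \<omega> = \<omega>" if "\<omega> \<in> \<Omega>" for \<omega>
      using pow_apply[of x \<omega> q] x(1,2) one_apply[OF that] that unfolding H by simp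
  qed (use x(1) assms(11) in \<open>auto simp: H\<close>)
  show ?thesis
  proof (intro conjI impI)
    assume nonab: "\<not> comm_group (perm_group \<Omega> N)"
    have "derived ?G N \<noteq> {\<one>\<^bsub>?G\<^esub>}"
      using comm_group_of_derived_trivial[OF Nsub] nonab by auto
    \<comment> \<open>The derived subgroup of \<open>N\<close> is normal in \<open>G\<close>, so \<open>N\<close> is perfect by minimality.\<close>
    then have "derived ?G N = N"
      using Nmin[OF derived_is_normal[OF Nn(1)] derived_incl[OF subset_refl Nsub]] by blast
    then obtain x where "x \<in> N" "x [^]\<^bsub>?G\<^esub> q = \<one>\<^bsub>?G\<^esub>" "\<forall>S\<in>\<B>. \<exists>s\<in>S. x s \<noteq> s"
      using exists_prime_order_element_moving_all_blocks by blast
    then show "intersection_density \<Omega> G = 1" using density assms(15) by blast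
  next
    assume "comm_group (perm_group \<Omega> N) \<and> (\<exists>h\<in>H. derangement \<Omega> h)"
    then obtain h where ab: "comm_group (perm_group \<Omega> N)" and h: "h \<in> H" "derangement \<Omega> h" by blast
    have hG: "h \<in> carrier ?G" using h(1) unfolding H by simp
    have comm: "m \<otimes>\<^bsub>?G\<^esub> n = n \<otimes>\<^bsub>?G\<^esub> m" if "m \<in> N" "n \<in> N" for m n
      using comm_groupE(4)[OF ab, of m n] that by simp
    have free: "h w \<noteq> w" if "w \<in> \<Omega>" for w using h(2) that unfolding derangement_def by blast
    have "h [^]\<^bsub>?G\<^esub> q = \<one>\<^bsub>?G\<^esub>"
    proof (rule eq_one)
      show "h [^]\<^bsub>?G\<^esub> q \<in> G" using nat_pow_closed[OF hG, of q] by simp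
      show "(h [^]\<^bsub>?G\<^esub> q) w = w" if w: "w \<in> \<Omega>" for w
      proof -
        obtain S where S: "S \<in> \<B>" "w \<in> S" using w partition_onD1[OF part] by blast
        show ?thesis
        proof (rule derangement_pow_prime_fixes[OF comm S(1) hG _ _ S(2)])
          show "h \<in> S \<rightarrow> S" using h(1) S(1) unfolding H by blast
          show "h y \<noteq> y" if "y \<in> S" for y using free BO[OF S(1)] that by blast
        qed
      qed
    qed
    moreover have "\<exists>s\<in>S. h s \<noteq> s" if S: "S \<in> \<B>" for S
    proof -
      have "S \<noteq> {}" using assms(11) S prime_gt_0_nat[OF q] by fastforce
      then show ?thesis using free BO[OF S] by blast
    qed
    ultimately show "intersection_density \<Omega> G = 1" using density h(1) by blast
  qed
qed

end
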